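(* Let $m,n\ge 1$, let $S\subseteq H_{mn}$ be nonseparated, and let $U$ be the subsemigroup of $H_{mn}$ generated by $S$. Then the closure $\overline{U}$ is a group.
   Context: For integers $m,n\ge 1$, $H_{mn}=\mathbb{R}^{m-1}\times\mathbb{R}\times\mathbb{R}^n$ denotes the simply connected Lie group (with the usual manifold structure) with product $(v,a,\mathbf b)(v',a',\mathbf b')=(v+v',\,a+a',\,\mathbf b+e^{a}\mathbf b')$, where $v,v'\in\mathbb{R}^{m-1}$, $a,a'\in\mathbb{R}$, $\mathbf b,\mathbf b'\in\mathbb{R}^n$. A maximal subsemigroup of a topological group $G$ (always understood: with nonempty interior) is a proper subsemigroup $M$ of $G$ with nonempty interior such that $M$ is not a group and the only subsemigroups of $G$ containing $M$ are $G$ and $M$. A subset $S$ of $G$ is nonseparated if it is not contained in any maximal subsemigroup of $G$. *)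

theory Defs
  imports "HOL-Analysis.Analysis" "HOL-Algebra.Group"
begin

text \<open>
  Throughout, a topological group is given by its group structure \<open>G\<close>, in the sense of HOL-Algebra,
  together with a topology \<open>T\<close> whose underlying set is the carrier of \<open>G\<close>.
\<close>

definition subsemigroup :: "('a, 'b) monoid_scheme \<Rightarrow> 'a set \<Rightarrow> bool"
  where "subsemigroup G M \<longleftrightarrow> M \<subseteq> carrier G \<and> (\<forall>x\<in>M. \<forall>y\<in>M. x \<otimes>\<^bsub>G\<^esub> y \<in> M)"

definition generated_subsemigroup :: "('a, 'b) monoid_scheme \<Rightarrow> 'a set \<Rightarrow> 'a set"
  where "generated_subsemigroup G S = subsemigroup G hull S"

definition maximal_subsemigroup :: "('a, 'b) monoid_scheme \<Rightarrow> 'a topology \<Rightarrow> 'a set \<Rightarrow> bool"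
  where "maximal_subsemigroup G T M \<longleftrightarrow>
    subsemigroup G M \<and> M \<noteq> carrier G \<and> T interior_of M \<noteq> {} \<and> \<not> subgroup M G \<and>
    (\<forall>N. subsemigroup G N \<and> M \<subseteq> N \<longrightarrow> N = carrier G \<or> N = M)"

definition nonseparated :: "('a, 'b) monoid_scheme \<Rightarrow> 'a topology \<Rightarrow> 'a set \<Rightarrow> bool"
  where "nonseparated G T S \<longleftrightarrow>
    S \<subseteq> carrier G \<and> \<not> (\<exists>M. maximal_subsemigroup G T M \<and> S \<subseteq> M)"

text \<open>
  Here \<open>\<real>\<^sup>k\<close> is \<^const>\<open>Euclidean_space\<close> \<open>k\<close>, whose points are the sequences of reals that vanish from
  index \<open>k\<close> on. In contrast to the finite Cartesian powers \<open>real ^ 'k\<close>, this admits the factor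
  \<open>\<real>\<^sup>0\<close>, which occurs for \<open>m = 1\<close>.
\<close>

type_synonym H_point = "(nat \<Rightarrow> real) \<times> real \<times> (nat \<Rightarrow> real)"

definition H_topology :: "nat \<Rightarrow> nat \<Rightarrow> H_point topology"
  where "H_topology m n =
    prod_topology (Euclidean_space (m - 1)) (prod_topology euclideanreal (Euclidean_space n))"

definition H_mult :: "H_point \<Rightarrow> H_point \<Rightarrow> H_point"
  where "H_mult = (\<lambda>(v, a, b) (v', a', b').
    ((\<lambda>i. v i + v' i), a + a', (\<lambda>i. b i + exp a * b' i)))"

definition H_group :: "nat \<Rightarrow> nat \<Rightarrow> H_point monoid"
  where "H_group m n =
    \<lparr>carrier = topspace (H_topology m n), mult = H_mult, one = ((\<lambda>i. 0), 0, (\<lambda>i. 0))\<rparr>"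

lemma carrier_H_group:
  "carrier (H_group m n) = {v. \<forall>i\<ge>m - 1. v i = 0} \<times> UNIV \<times> {b. \<forall>i\<ge>n. b i = 0}"
  by (simp add: H_group_def H_topology_def topspace_Euclidean_space)

lemma group_H_group: "group (H_group m n)"
proof (rule groupI)
  fix x assume "x \<in> carrier (H_group m n)"
  then obtain v a b where x: "x = (v, a, b)"
    and v: "\<forall>i\<ge>m - 1. v i = 0" and b: "\<forall>i\<ge>n. b i = 0"
    by (auto simp: carrier_H_group)
  let ?y = "((\<lambda>i. - v i), - a, (\<lambda>i. - exp (- a) * b i))"
  have "?y \<in> carrier (H_group m n)"
    using v b by (simp add: carrier_H_group)
  moreover have "?y \<otimes>\<^bsub>H_group m n\<^esub> x = \<one>\<^bsub>H_group m n\<^esub>"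
    by (simp add: x H_group_def H_mult_def)
  ultimately show "\<exists>y\<in>carrier (H_group m n). y \<otimes>\<^bsub>H_group m n\<^esub> x = \<one>\<^bsub>H_group m n\<^esub>"
    by blast
next
  fix x y assume "x \<in> carrier (H_group m n)" "y \<in> carrier (H_group m n)"
  then show "x \<otimes>\<^bsub>H_group m n\<^esub> y \<in> carrier (H_group m n)"
    by (auto simp: carrier_H_group) (auto simp: H_group_def H_mult_def)
next
  show "\<one>\<^bsub>H_group m n\<^esub> \<in> carrier (H_group m n)"
    by (simp add: carrier_H_group) (simp add: H_group_def)
qed (auto simp: H_group_def H_mult_def algebra_simps exp_add split: prod.splits)

end

theory Submission
  imports Defs
begin

text \<open>
  An element \<open>(v, a, b)\<close> of the group acts on \<open>\<real>\<^sup>n\<close> by the similarity \<open>x \<mapsto> e\<^sup>a x + b\<close>, and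
  \<open>(v, a, b) \<mapsto> (v, a)\<close> is a homomorphism onto \<open>\<real>\<^sup>m\<close>; its value is called the shadow below.
  Two families of half-spaces are maximal subsemigroups: the preimages of the half-spaces
  \<open>{y. c \<bullet> y \<ge> 0}\<close> under the shadow, and, for a linear form \<open>\<nu> \<noteq> 0\<close> on \<open>\<real>\<^sup>n\<close>, the elements whose
  induced affine map of the line, \<open>t \<mapsto> e\<^sup>a t + \<nu> \<bullet> b\<close>, does not move a given point \<open>p\<close> to the left.
  These two families suffice: the closure \<open>T\<close> of \<open>U\<close> is shown to be a group whenever \<open>S\<close> is contained
  in no member of either.

  Since \<open>T\<close> escapes every half-space of the first kind, the shadows of its elements span \<open>\<real>\<^sup>m\<close> with
  nonnegative coefficients, and simultaneous Diophantine approximation turns every relation with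
  nonnegative real coefficients into words whose shadow is close to zero and in which
  prescribed letters occur arbitrarily often (\<open>shadow_recurrence\<close>).
  The point is to control the \<open>\<real>\<^sup>n\<close>-component of such words. Let \<open>h\<close> be a contraction (\<open>a < 0\<close>) with
  fixed point \<open>q\<close> and \<open>g\<close> an expansion (\<open>a > 0\<close>) with fixed point \<open>p\<close>. Order the word so that the
  contractions act last, a high power of \<open>h\<close> at the very end, and the expansions act first, beginning
  with a high power of \<open>g\<close>. The contracting half of the word then has translation part close to \<open>q\<close>, and so has
  the inverse of the expanding half close to \<open>p\<close>. In the limit the word is the translation by \<open>q - p\<close>,
  which therefore belongs to \<open>T\<close> (\<open>translation_between_fixpts\<close>).

  Once a translation by \<open>c\<close> lies in \<open>T\<close>, composing with multiples of it moves the fixed point of a power of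
  \<open>h\<close> by arbitrarily small steps in direction \<open>c\<close>, so \<open>q - p + r c\<close> is again a translation in \<open>T\<close> for
  every \<open>r \<ge> 0\<close> (\<open>translations_scaled\<close>). Hence the directions \<open>x\<close> with \<open>q - p + r x \<in> T\<close> for all
  \<open>r \<ge> 0\<close> form a convex cone containing all differences between fixed points of contractions and of expansions.
  If that cone were not \<open>\<real>\<^sup>n\<close>, a linear form \<open>\<nu>\<close> would be nonnegative on it, so it would place every fixed
  point of an expansion to the left of every fixed point of a contraction, and any point in between would
  give a half-space of the second kind containing \<open>T\<close>. So \<open>T\<close> contains all translations
  (\<open>all_translations\<close>). Finally, recurrence gives elements of \<open>T\<close> whose shadows approach that of \<open>x\<^sup>-\<^sup>1\<close>,
  and a translation corrects the remaining component (\<open>inverse_mem\<close>).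
\<close>

section \<open>Separation of convex cones in \<open>\<real>\<^sup>n\<close>\<close>

text \<open>
  This is the extension theorem of M. Riesz, one coordinate at a time: the functional is
  \<open>\<sigma> x\<^sub>n - (\<Sum>i<j. s\<^sub>i x\<^sub>i)\<close>, nonnegative on the part of \<open>K\<close> in the span of \<open>e\<^sub>0, \<dots>, e\<^sub>j\<^sub>-\<^sub>1, e\<^sub>n\<close>.
  Adding a point of \<open>K\<close> with \<open>j\<close>-th coordinate 1 to one with \<open>j\<close>-th coordinate \<open>-1\<close> lands in the
  smaller span, so the lower and upper bounds that \<open>K\<close> imposes on \<open>s\<^sub>j\<close> are compatible. The assumption
  that \<open>K\<close> meets every line parallel to \<open>e\<^sub>n\<close> makes both sets of bounds nonempty.
\<close>

lemma Riesz_extension: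
  fixes K :: "(nat \<Rightarrow> real) set" and \<sigma> :: real
  assumes sub: "\<And>x i. x \<in> K \<Longrightarrow> i > n \<Longrightarrow> x i = 0"
    and add: "\<And>x y. x \<in> K \<Longrightarrow> y \<in> K \<Longrightarrow> (\<lambda>i. x i + y i) \<in> K"
    and scale: "\<And>x r. x \<in> K \<Longrightarrow> r > 0 \<Longrightarrow> (\<lambda>i. r * x i) \<in> K"
    and full: "\<And>y. (\<forall>i\<ge>n. y i = 0) \<Longrightarrow> \<exists>t. y(n := t) \<in> K"
    and pos: "\<And>t. (\<lambda>i. 0)(n := t) \<in> K \<Longrightarrow> \<sigma> * t \<ge> 0"
    and "j \<le> n"
  shows "\<exists>s. \<forall>x\<in>K. (\<forall>i. j \<le> i \<and> i < n \<longrightarrow> x i = 0) \<longrightarrow> (\<Sum>i<j. s i * x i) \<le> \<sigma> * x n"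
  using \<open>j \<le> n\<close>
proof (induction j)
  case 0
  have "\<sigma> * x n \<ge> 0" if "x \<in> K" "\<forall>i. 0 \<le> i \<and> i < n \<longrightarrow> x i = 0" for x
  proof -
    have "x = (\<lambda>i. 0)(n := x n)"
    proof
      fix i show "x i = ((\<lambda>i. 0)(n := x n)) i"
        using that sub[OF that(1), of i] by (cases i n rule: linorder_cases) auto
    qed
    with that pos show ?thesis by metis
  qed
  then show ?case by auto
next
  case (Suc j)
  then obtain s where s: "\<And>x. x \<in> K \<Longrightarrow> (\<And>i. j \<le> i \<Longrightarrow> i < n \<Longrightarrow> x i = 0) \<Longrightarrow> (\<Sum>i<j. s i * x i) \<le> \<sigma> * x n"
    by (metis Suc_leD)
  have jn: "j < n" using Suc.prems by simp
  define \<nu> where "\<nu> x = \<sigma> * x n - (\<Sum>i<j. s i * x i)" for x :: "nat \<Rightarrow> real"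
  define A where "A c = {x \<in> K. x j = c \<and> (\<forall>i. j < i \<and> i < n \<longrightarrow> x i = 0)}" for c :: real
  have A_ne: "\<exists>x. x \<in> A c" for c
  proof -
    obtain t where "((\<lambda>i. 0)(j := c))(n := t) \<in> K"
      using full[of "(\<lambda>i. 0)(j := c)"] jn by auto
    then have "((\<lambda>i. 0)(j := c))(n := t) \<in> A c"
      using jn by (auto simp: A_def)
    then show ?thesis by blast
  qed
  have compat: "- \<nu> y \<le> \<nu> x" if "x \<in> A 1" "y \<in> A (-1)" for x y
  proof -
    have "(\<lambda>i. x i + y i) \<in> K" using that add by (auto simp: A_def)
    moreover have "x i + y i = 0" if "j \<le> i" "i < n" for i
      using that \<open>x \<in> A 1\<close> \<open>y \<in> A (-1)\<close> by (cases "i = j") (auto simp: A_def)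
    ultimately have "(\<Sum>i<j. s i * (x i + y i)) \<le> \<sigma> * (x n + y n)" by (rule s)
    then show ?thesis
      by (simp add: \<nu>_def algebra_simps sum.distrib)
  qed
  obtain y0 where y0: "y0 \<in> A (-1)" using A_ne by blast
  define c where "c = (INF x\<in>A 1. \<nu> x)"
  have bdd: "bdd_below (\<nu> ` A 1)"
    using compat[OF _ y0] by (intro bdd_belowI2[of _ "- \<nu> y0"])
  have c_le: "c \<le> \<nu> x" if "x \<in> A 1" for x
    unfolding c_def using bdd that by (rule cINF_lower)
  have c_ge: "- \<nu> y \<le> c" if "y \<in> A (-1)" for y
    unfolding c_def using A_ne[of 1] compat[OF _ that] by (intro cINF_greatest) auto
  have \<nu>_scale: "\<nu> (\<lambda>i. r * x i) = r * \<nu> x" for r x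
    by (simp add: \<nu>_def algebra_simps sum_distrib_left)
  have key: "c * x j \<le> \<nu> x" if x: "x \<in> K" "\<And>i. Suc j \<le> i \<Longrightarrow> i < n \<Longrightarrow> x i = 0" for x
  proof (cases "x j" "0 :: real" rule: linorder_cases)
    case equal
    then have "\<nu> x \<ge> 0"
      unfolding \<nu>_def using s[OF x(1)] x(2) by (metis Suc_leI diff_ge_0_iff_ge le_neq_implies_less)
    with equal show ?thesis by simp
  next
    case greater
    then have "(\<lambda>i. inverse (x j) * x i) \<in> A 1"
      using scale[OF x(1), of "inverse (x j)"] x(2) by (auto simp: A_def)
    from c_le[OF this] greater show ?thesis unfolding \<nu>_scale by (simp add: field_simps)
  next
    case less
    then have "(\<lambda>i. inverse (- x j) * x i) \<in> A (-1)"
      using scale[OF x(1), of "inverse (- x j)"] x(2) by (auto simp: A_def)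
    from c_ge[OF this] less show ?thesis unfolding \<nu>_scale by (simp add: field_simps)
  qed
  show ?case
  proof (intro exI[of _ "s(j := c)"] ballI impI)
    fix x assume "x \<in> K" "\<forall>i. Suc j \<le> i \<and> i < n \<longrightarrow> x i = 0"
    then have "c * x j \<le> \<nu> x" by (intro key) auto
    then show "(\<Sum>i<Suc j. (s(j := c)) i * x i) \<le> \<sigma> * x n"
      by (simp add: \<nu>_def)
  qed
qed

text \<open>
  The cone need not be closed. If its projection along the last coordinate is still a proper cone, a
  functional of the first coordinates works by induction. Otherwise the cone meets every line
  parallel to the last axis; it cannot contain both directions of that axis without being everything, so
  one direction is missing and \<open>Riesz_extension\<close> applies, starting from that axis.
\<close>

lemma convex_cone_separation:
  fixes K :: "(nat \<Rightarrow> real) set"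
  assumes sub: "\<And>x i. x \<in> K \<Longrightarrow> i \<ge> n \<Longrightarrow> x i = 0"
    and zero: "(\<lambda>i. 0) \<in> K"
    and add: "\<And>x y. x \<in> K \<Longrightarrow> y \<in> K \<Longrightarrow> (\<lambda>i. x i + y i) \<in> K"
    and scale: "\<And>x r. x \<in> K \<Longrightarrow> r > 0 \<Longrightarrow> (\<lambda>i. r * x i) \<in> K"
    and z: "\<forall>i\<ge>n. z i = 0" "z \<notin> K"
  shows "\<exists>c. (\<exists>i<n. c i \<noteq> 0) \<and> (\<forall>x\<in>K. 0 \<le> (\<Sum>i<n. c i * x i))"
  using assms
proof (induction n arbitrary: K z)
  case 0
  then have "z = (\<lambda>i. 0)" by auto
  with 0 show ?case by simp
next
  case (Suc n)
  define L where "L = (\<lambda>x. x(n := 0)) ` K"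
  have upd_add: "(\<lambda>i. (x(n := 0)) i + (y(n := 0)) i) = (\<lambda>i. x i + y i)(n := 0)"
    and upd_scale: "(\<lambda>i. r * (x(n := 0)) i) = (\<lambda>i. r * x i)(n := 0)" for x y :: "nat \<Rightarrow> real" and r :: real
    by auto
  show ?case
  proof (cases "\<forall>y. (\<forall>i\<ge>n. y i = 0) \<longrightarrow> y \<in> L")
    case False
    then obtain y where y: "\<forall>i\<ge>n. y i = 0" "y \<notin> L" by blast
    have "\<exists>c. (\<exists>i<n. c i \<noteq> 0) \<and> (\<forall>x\<in>L. 0 \<le> (\<Sum>i<n. c i * x i))"
    proof (rule Suc.IH[OF _ _ _ _ y])
      show "x i = 0" if "x \<in> L" "n \<le> i" for x i
        using that Suc.prems(1)[of _ i] by (cases "i = n") (auto simp: L_def)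
      show "(\<lambda>i. 0) \<in> L" using Suc.prems(2) by (force simp: L_def)
      show "(\<lambda>i. x i + x' i) \<in> L" if "x \<in> L" "x' \<in> L" for x x'
      proof -
        from that obtain y y' where "y \<in> K" "y' \<in> K" "x = y(n := 0)" "x' = y'(n := 0)"
          unfolding L_def by blast
        then show ?thesis
          using imageI[OF Suc.prems(3), of y y' "\<lambda>x. x(n := 0)"]
          by (simp only: L_def upd_add)
      qed
      show "(\<lambda>i. r * x i) \<in> L" if "x \<in> L" "r > 0" for x r
      proof -
        from that obtain y where "y \<in> K" "x = y(n := 0)"
          unfolding L_def by blast
        then show ?thesis
          using imageI[OF Suc.prems(4), of y r "\<lambda>x. x(n := 0)"] that(2)
          by (simp only: L_def upd_scale)
      qed
    qed
    then obtain c i where c: "i < n" "c i \<noteq> 0" "\<And>x. x \<in> K \<Longrightarrow> 0 \<le> (\<Sum>i<n. c i * x i)"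
      by (auto simp: L_def)
    show ?thesis
    proof (intro exI[of _ "c(n := 0)"] conjI ballI)
      show "\<exists>i<Suc n. (c(n := 0)) i \<noteq> 0" using c(1,2) by (intro exI[of _ i]) auto
      show "0 \<le> (\<Sum>i<Suc n. (c(n := 0)) i * x i)" if "x \<in> K" for x
        using c(3)[OF that] by simp
    qed
  next
    case True
    have full: "\<exists>t. y(n := t) \<in> K" if "\<forall>i\<ge>n. y i = 0" for y
    proof -
      have "y \<in> L" using True that by blast
      then obtain x where "x \<in> K" "y = x(n := 0)" unfolding L_def by (rule imageE)
      then have "y(n := x n) \<in> K" by simp
      then show ?thesis ..
    qed
    \<comment> \<open>\<open>\<sigma>\<close> is the orientation of the last axis for which the cone misses the negative half-axis.\<close>
    have "\<exists>\<sigma>. \<bar>\<sigma>\<bar> = 1 \<and> (\<lambda>i. 0)(n := - \<sigma>) \<notin> K"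
    proof (rule ccontr)
      assume "\<not> ?thesis"
      then have e: "(\<lambda>i. 0)(n := - \<sigma>) \<in> K" if "\<bar>\<sigma>\<bar> = 1" for \<sigma>
        using that by blast
      have line: "(\<lambda>i. 0)(n := t) \<in> K" for t
      proof (cases "t = 0")
        case True
        then show ?thesis using Suc.prems(2) by (simp add: fun_upd_idem)
      next
        case False
        have "(\<lambda>i. \<bar>t\<bar> * ((\<lambda>i. 0)(n := - (- sgn t))) i) \<in> K"
          using False by (intro Suc.prems(4) e) (auto simp: sgn_if)
        also have "(\<lambda>i. \<bar>t\<bar> * ((\<lambda>i. 0)(n := - (- sgn t))) i) = (\<lambda>i. 0)(n := t)"
          by (auto simp: abs_mult_sgn)
        finally show ?thesis .
      qed
      have "\<forall>i\<ge>n. (z(n := 0)) i = 0" using Suc.prems(5) by auto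
      from full[OF this] obtain t where t: "z(n := t) \<in> K"
        unfolding fun_upd_upd by blast
      have "(\<lambda>i. (z(n := t)) i + ((\<lambda>i. 0)(n := z n - t)) i) \<in> K"
        using t line by (rule Suc.prems(3))
      also have "(\<lambda>i. (z(n := t)) i + ((\<lambda>i. 0)(n := z n - t)) i) = z" by auto
      finally show False using Suc.prems(6) by simp
    qed
    then obtain \<sigma> where \<sigma>: "\<bar>\<sigma>\<bar> = 1" "(\<lambda>i. 0)(n := - \<sigma>) \<notin> K" by blast
    have pos: "\<sigma> * t \<ge> 0" if t: "(\<lambda>i. 0)(n := t) \<in> K" for t
    proof (rule ccontr)
      assume neg: "\<not> \<sigma> * t \<ge> 0"
      then have "t \<noteq> 0" by auto
      have "inverse \<bar>t\<bar> * t = - \<sigma>"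
        using neg \<sigma>(1) by (cases "t > 0") (auto simp: abs_if mult_less_0_iff not_le field_simps split: if_splits)
      moreover have "(\<lambda>i. inverse \<bar>t\<bar> * ((\<lambda>i. 0)(n := t)) i) \<in> K"
        using \<open>t \<noteq> 0\<close> by (intro Suc.prems(4) t) auto
      moreover have "(\<lambda>i. inverse \<bar>t\<bar> * ((\<lambda>i. 0)(n := t)) i) = (\<lambda>i. 0)(n := inverse \<bar>t\<bar> * t)"
        by auto
      ultimately show False using \<sigma>(2) by simp
    qed
    have "\<exists>s. \<forall>x\<in>K. (\<forall>i. n \<le> i \<and> i < n \<longrightarrow> x i = 0) \<longrightarrow> (\<Sum>i<n. s i * x i) \<le> \<sigma> * x n"
      by (rule Riesz_extension[where K = K and n = n and j = n and \<sigma> = \<sigma>])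
         (use Suc.prems(1) in simp, fact Suc.prems(3), fact Suc.prems(4), fact full, fact pos, simp)
    then obtain s where s: "\<And>x. x \<in> K \<Longrightarrow> (\<Sum>i<n. s i * x i) \<le> \<sigma> * x n" by auto
    show ?thesis
    proof (intro exI[of _ "(\<lambda>i. - s i)(n := \<sigma>)"] conjI ballI)
      show "\<exists>i<Suc n. ((\<lambda>i. - s i)(n := \<sigma>)) i \<noteq> 0" using \<sigma>(1) by (intro exI[of _ n]) auto
      show "0 \<le> (\<Sum>i<Suc n. ((\<lambda>i. - s i)(n := \<sigma>)) i * x i)" if "x \<in> K" for x
        using s[OF that] by (simp add: sum_negf)
    qed
  qed
qed

section \<open>Simultaneous approximation\<close>

text \<open>
  Besides passing to an arbitrary finite index set, this asks for large denominators, obtained by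
  approximating the multiples of \<open>r\<close> by \<open>N0 + 1\<close>, and for natural numerators: a numerator within distance 1 of
  a nonnegative number is nonnegative.
\<close>

lemma Dirichlet_approx_finite:
  fixes r :: "'a \<Rightarrow> real"
  assumes "finite F" "\<And>u. u \<in> F \<Longrightarrow> r u \<ge> 0" "\<epsilon> > 0"
  shows "\<exists>N k. N > N0 \<and> (\<forall>u\<in>F. \<bar>real N * r u - real (k u)\<bar> < \<epsilon>)"
proof -
  obtain f where f: "bij_betw f {..<card F} F"
    using ex_bij_betw_nat_finite[OF assms(1)] by (auto simp: atLeast0LessThan)
  obtain M :: nat where M: "M > 0" "1 / real M < \<epsilon>"
    using assms(3) by (meson nat_approx_posE of_nat_0_less_iff zero_less_Suc)
  obtain q p where qp: "0 < q"
    "\<And>i. i < card F \<Longrightarrow> \<bar>of_int q * (real (Suc N0) * r (f i)) - of_int (p i)\<bar> < 1 / real M"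
    using Dirichlet_approx_simult[OF M(1), of "card F" "\<lambda>i. real (Suc N0) * r (f i)"] by metis
  define g where "g = the_inv_into {..<card F} f"
  have g: "g u < card F" "f (g u) = u" if "u \<in> F" for u
    using f that unfolding g_def
    by (metis bij_betw_def lessThan_iff subset_refl the_inv_into_into)
       (metis f f_the_inv_into_f_bij_betw that)
  define k where "k u = nat (p (g u))" for u
  have "\<bar>real (nat q * Suc N0) * r u - real (k u)\<bar> < \<epsilon>" if u: "u \<in> F" for u
  proof -
    have *: "\<bar>of_int q * (real (Suc N0) * r u) - of_int (p (g u))\<bar> < 1 / real M"
      using qp(2)[of "g u"] g[OF u] by simp
    moreover have "1 / real M \<le> 1" using M(1) by simp
    moreover have "0 \<le> of_int q * (real (Suc N0) * r u)"
      using qp(1) assms(2)[OF u] by simp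
    ultimately have "of_int (p (g u)) > (-1 :: real)" by linarith
    then have "p (g u) \<ge> 0" by linarith
    moreover have "real (nat q * Suc N0) = of_int q * real (Suc N0)"
      using qp(1) by (simp only: of_nat_mult of_nat_nat less_imp_le)
    ultimately show ?thesis using * M(2) by (simp only: k_def mult.assoc of_nat_nat)
  qed
  moreover have "nat q * Suc N0 > N0"
  proof -
    have "1 * Suc N0 \<le> nat q * Suc N0" using qp(1) by (intro mult_le_mono1) auto
    then show ?thesis by simp
  qed
  ultimately show ?thesis by blast
qed

section \<open>The group \<open>H\<^sub>m\<^sub>n\<close> and its topology\<close>

definition H_inv :: "H_point \<Rightarrow> H_point"
  where "H_inv = (\<lambda>(v, a, b). ((\<lambda>i. - v i), - a, (\<lambda>i. - exp (- a) * b i)))"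

lemma H_inv_simp [simp]: "H_inv (v, a, b) = ((\<lambda>i. - v i), - a, (\<lambda>i. - exp (- a) * b i))"
  by (simp add: H_inv_def)

text \<open>
  The product makes sense for arbitrary sequences and obeys the group laws on the whole type, so the algebra
  below is free of carrier conditions.
\<close>

lemma H_group_simps [simp]:
  "mult (H_group m n) = H_mult" "one (H_group m n) = ((\<lambda>i. 0), 0, (\<lambda>i. 0))"
  by (auto simp: H_group_def)

lemma H_mult_simp [simp]:
  "H_mult (v, a, b) (v', a', b') = ((\<lambda>i. v i + v' i), a + a', (\<lambda>i. b i + exp a * b' i))"
  by (simp add: H_mult_def)

lemma H_mult_assoc: "H_mult (H_mult x y) z = H_mult x (H_mult y z)"
  by (cases x; cases y; cases z) (simp add: algebra_simps exp_add)

lemma H_mult_one [simp]: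
  "H_mult ((\<lambda>i. 0), 0, (\<lambda>i. 0)) x = x" "H_mult x ((\<lambda>i. 0), 0, (\<lambda>i. 0)) = x"
  by (cases x; simp)+

lemma H_inv_mult [simp]:
  "H_mult (H_inv x) x = ((\<lambda>i. 0), 0, (\<lambda>i. 0))" "H_mult x (H_inv x) = ((\<lambda>i. 0), 0, (\<lambda>i. 0))"
  by (cases x; simp flip: mult.assoc exp_add)+

lemma H_inv_carrier: "x \<in> carrier (H_group m n) \<Longrightarrow> H_inv x \<in> carrier (H_group m n)"
  by (auto simp: carrier_H_group)

lemma H_mult_carrier:
  "x \<in> carrier (H_group m n) \<Longrightarrow> y \<in> carrier (H_group m n) \<Longrightarrow> H_mult x y \<in> carrier (H_group m n)"
  by (auto simp: carrier_H_group)

text \<open>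
  Thanks to this, closures and limits in the group can be computed in the type, where convergence is
  coordinatewise.
\<close>

lemma H_topology_eq: "H_topology m n = top_of_set (carrier (H_group m n))"
proof -
  have "prod_topology euclideanreal (top_of_set T) = top_of_set (UNIV \<times> T)" for T :: "(nat \<Rightarrow> real) set"
    using prod_topology_subtopology_eu[of "UNIV :: real set" T] by simp
  then show ?thesis
    by (simp add: H_topology_def carrier_H_group Euclidean_space_def euclidean_product_topology)
qed

lemma tendsto_fun_iff:
  fixes f :: "'a \<Rightarrow> 'b \<Rightarrow> 'c::topological_space"
  shows "(f \<longlongrightarrow> l) F \<longleftrightarrow> (\<forall>i. ((\<lambda>x. f x i) \<longlongrightarrow> l i) F)"
  by (simp add: limitin_componentwise flip: euclidean_product_topology limitin_canonical_iff)

lemma closed_carrier_H_group: "closed (carrier (H_group m n))"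
proof -
  have "closed {x :: nat \<Rightarrow> real. \<forall>i\<ge>k. x i = 0}" for k
    using closedin_Euclidean_imp_closed[OF closedin_topspace, of k]
    by (simp add: topspace_Euclidean_space)
  then show ?thesis unfolding carrier_H_group by (intro closed_Times) auto
qed

lemma closed_H_limit:
  fixes x :: "nat \<Rightarrow> H_point"
  assumes "closed T" "\<And>k. x k \<in> T" 
    "\<And>i. (\<lambda>k. fst (x k) i) \<longlonglongrightarrow> v i"
    "(\<lambda>k. fst (snd (x k))) \<longlonglongrightarrow> a"
    "\<And>i. (\<lambda>k. snd (snd (x k)) i) \<longlonglongrightarrow> b i"
  shows "(v, a, b) \<in> T"
proof -
  have "(\<lambda>k. (fst (x k), fst (snd (x k)), snd (snd (x k)))) \<longlonglongrightarrow> (v, a, b)"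
    by (intro tendsto_Pair) (auto simp: tendsto_fun_iff assms)
  then have "x \<longlonglongrightarrow> (v, a, b)" by simp
  then show ?thesis using assms(1,2) by (meson closed_sequentially)
qed

lemma continuous_H_mult: "continuous_on UNIV (\<lambda>(x, y). H_mult x y)"
  unfolding H_mult_def case_prod_unfold
  by (intro continuous_intros continuous_on_product_then_coordinatewise)

lemma closure_subsemigroup:
  assumes "\<And>x y. x \<in> U \<Longrightarrow> y \<in> U \<Longrightarrow> H_mult x y \<in> U"
    and "x \<in> closure U" "y \<in> closure U"
  shows "H_mult x y \<in> closure U"
proof -
  have "(\<lambda>(x, y). H_mult x y) ` closure (U \<times> U) \<subseteq> closure U"
    using assms(1) closure_subset[of U]
    by (intro image_closure_subset continuous_on_subset[OF continuous_H_mult]) auto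
  moreover have "(x, y) \<in> closure (U \<times> U)" using assms(2,3) by (simp add: closure_Times)
  ultimately show ?thesis by force
qed

section \<open>Half-spaces are maximal subsemigroups\<close>

text \<open>
  For maximality it is enough that a larger subsemigroup \<open>N\<close> contains, for every \<open>y\<close>, some \<open>w\<close> with
  \<open>w\<^sup>-\<^sup>1 y \<in> M\<close>, because then \<open>y = w (w\<^sup>-\<^sup>1 y)\<close>.
\<close>

lemma maximal_subsemigroupI:
  assumes M: "M \<subseteq> carrier (H_group m n)"
    and mult: "\<And>x y. x \<in> M \<Longrightarrow> y \<in> M \<Longrightarrow> H_mult x y \<in> M"
    and op: "open W" "W \<inter> carrier (H_group m n) \<noteq> {}" "W \<inter> carrier (H_group m n) \<subseteq> M"
    and g: "g \<in> M" "H_inv g \<notin> M"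
    and gen: "\<And>N x y. M \<subseteq> N \<Longrightarrow> N \<subseteq> carrier (H_group m n) \<Longrightarrow> (\<And>x y. x \<in> N \<Longrightarrow> y \<in> N \<Longrightarrow> H_mult x y \<in> N) \<Longrightarrow>
      x \<in> N \<Longrightarrow> x \<notin> M \<Longrightarrow> y \<in> carrier (H_group m n) \<Longrightarrow> \<exists>w\<in>N. H_mult (H_inv w) y \<in> M"
  shows "maximal_subsemigroup (H_group m n) (H_topology m n) M"
  unfolding maximal_subsemigroup_def
proof (intro conjI allI impI)
  let ?C = "carrier (H_group m n)"
  show "subsemigroup (H_group m n) M" using M mult by (auto simp: subsemigroup_def)
  have inv_g: "H_inv g \<in> ?C" using g(1) M H_inv_carrier by blast
  then show "M \<noteq> ?C" using g(2) by blast
  have "openin (H_topology m n) (W \<inter> ?C)" using op(1) by (auto simp: H_topology_eq openin_open)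
  then have "W \<inter> ?C \<subseteq> H_topology m n interior_of M" using op(3)
    by (intro interior_of_maximal)
  then show "H_topology m n interior_of M \<noteq> {}" using op(2) by blast
  show "\<not> subgroup M (H_group m n)"
  proof
    interpret group "H_group m n" by (rule group_H_group)
    assume "subgroup M (H_group m n)"
    then have "inv\<^bsub>H_group m n\<^esub> g \<in> M" using g(1) by (rule subgroup.m_inv_closed)
    moreover have "inv\<^bsub>H_group m n\<^esub> g = H_inv g"
      by (rule inv_equality) (use subsetD[OF M g(1)] inv_g in simp_all)
    ultimately show False using g(2) by simp
  qed
  fix N assume N: "subsemigroup (H_group m n) N \<and> M \<subseteq> N"
  then have N': "N \<subseteq> ?C" "\<And>x y. x \<in> N \<Longrightarrow> y \<in> N \<Longrightarrow> H_mult x y \<in> N"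
    by (auto simp: subsemigroup_def)
  show "N = ?C \<or> N = M"
  proof (cases "N \<subseteq> M")
    case False
    then obtain x where x: "x \<in> N" "x \<notin> M" by blast
    have "y \<in> N" if y: "y \<in> ?C" for y
    proof -
      obtain w where w: "w \<in> N" "H_mult (H_inv w) y \<in> M"
        using gen[OF conjunct2[OF N] N' x y] by blast
      have "H_mult w (H_mult (H_inv w) y) \<in> N" using N N'(2) w by blast
      then show ?thesis by (simp flip: H_mult_assoc)
    qed
    with N' show ?thesis by blast
  qed (use N in blast)
qed

lemma continuous_on_coordinates:
  "continuous_on UNIV (\<lambda>x :: H_point. fst x i)" "continuous_on UNIV (\<lambda>x :: H_point. snd (snd x) i)"
  by (rule continuous_on_product_then_coordinatewise, intro continuous_intros)+

abbreviation log_scale :: "H_point \<Rightarrow> real" where "log_scale x \<equiv> fst (snd x)"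
abbreviation offset :: "H_point \<Rightarrow> nat \<Rightarrow> real" where "offset x \<equiv> snd (snd x)"
abbreviation translation :: "(nat \<Rightarrow> real) \<Rightarrow> H_point" where "translation b \<equiv> ((\<lambda>i. 0), 0, b)"

text \<open>
  The homomorphism \<open>(v, a, b) \<mapsto> (v, a)\<close> onto \<open>\<real>\<^sup>m\<close>, with \<open>a\<close> stored as the coordinate of index \<open>m - 1\<close>,
  where \<open>v\<close> vanishes; so its values are again sequences vanishing from an index on, as for \<open>\<real>\<^sup>n\<close>.
\<close>

definition shadow :: "nat \<Rightarrow> H_point \<Rightarrow> nat \<Rightarrow> real"
  where "shadow m x = (fst x)(m - 1 := log_scale x)"

lemma shadow_mult: "shadow m (H_mult x y) i = shadow m x i + shadow m y i"
  by (cases x; cases y) (simp add: shadow_def)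

lemma shadow_inv: "shadow m (H_inv x) i = - shadow m x i"
  by (cases x) (simp add: shadow_def)

lemma shadow_vanishes: "x \<in> carrier (H_group m n) \<Longrightarrow> m \<ge> 1 \<Longrightarrow> i \<ge> m \<Longrightarrow> shadow m x i = 0"
  by (auto simp: shadow_def carrier_H_group)

lemma shadow_surj:
  assumes "\<forall>i\<ge>m. y i = 0"
  shows "(y(m - 1 := 0), y (m - 1), (\<lambda>i. 0)) \<in> carrier (H_group m n)"
    "shadow m (y(m - 1 := 0), y (m - 1), (\<lambda>i. 0)) = y"
  using assms by (auto simp: shadow_def carrier_H_group)

text \<open>
  An element outside the half-space has a negative value under the homomorphism \<open>\<phi>\<close>, so its powers reach
  values below that of any given \<open>y\<close>.
\<close>

lemma maximal_half_space_shadow: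
  assumes "m \<ge> 1" and c: "i0 < m" "c i0 \<noteq> 0"
  shows "maximal_subsemigroup (H_group m n) (H_topology m n)
    {x \<in> carrier (H_group m n). 0 \<le> (\<Sum>i<m. c i * shadow m x i)}"
proof -
  define \<phi> where "\<phi> x = (\<Sum>i<m. c i * shadow m x i)" for x
  have \<phi>_mult: "\<phi> (H_mult x y) = \<phi> x + \<phi> y" for x y
    by (simp add: \<phi>_def shadow_mult algebra_simps sum.distrib)
  have \<phi>_inv: "\<phi> (H_inv x) = - \<phi> x" for x
    by (simp add: \<phi>_def shadow_inv sum_negf)
  obtain g where g: "g \<in> carrier (H_group m n)" "\<phi> g > 0"
  proof -
    define y where "y i = (if i = i0 then c i0 else 0)" for i
    have y: "\<forall>i\<ge>m. y i = 0" using c by (auto simp: y_def)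
    have "(\<Sum>i<m. c i * y i) = c i0 * c i0"
      using c by (simp add: y_def if_distrib cong: if_cong)
    then have "0 < (\<Sum>i<m. c i * y i)"
      using c(2) by (auto simp: zero_less_mult_iff linorder_neq_iff)
    then show thesis
      using that[OF shadow_surj(1)[OF y]] shadow_surj(2)[OF y] by (simp add: \<phi>_def)
  qed
  have "continuous_on UNIV (\<lambda>x. shadow m x i)" for i
    by (cases "i = m - 1") (simp_all add: shadow_def continuous_on_coordinates continuous_intros)
  then have cont: "continuous_on UNIV \<phi>"
    unfolding \<phi>_def by (intro continuous_intros)
  have "maximal_subsemigroup (H_group m n) (H_topology m n) {x \<in> carrier (H_group m n). 0 \<le> \<phi> x}"
  proof (rule maximal_subsemigroupI[where W = "{x. 0 < \<phi> x}" and g = g])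
    show "open {x. 0 < \<phi> x}" using cont by (intro open_Collect_less) auto
    fix N x y
    assume N: "\<And>x y. x \<in> N \<Longrightarrow> y \<in> N \<Longrightarrow> H_mult x y \<in> N" "N \<subseteq> carrier (H_group m n)"
      and x: "x \<in> N" "x \<notin> {x \<in> carrier (H_group m n). 0 \<le> \<phi> x}"
      and y: "y \<in> carrier (H_group m n)"
    have neg: "- \<phi> x > 0" using x N(2) by auto
    then obtain k :: nat where k: "- \<phi> y < real k * - \<phi> x" using reals_Archimedean3 by blast
    have pow: "\<exists>w\<in>N. \<phi> w = real (Suc k) * \<phi> x" for k
    proof (induction k)
      case (Suc k)
      then obtain w where "w \<in> N" "\<phi> w = real (Suc k) * \<phi> x" by blast
      then show ?case using N(1)[OF _ x(1), of w]
        by (intro bexI[of _ "H_mult w x"]) (simp_all add: \<phi>_mult algebra_simps)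
    qed (use x in auto)
    obtain w where w: "w \<in> N" "\<phi> w = real (Suc k) * \<phi> x" using pow by blast
    have "H_mult (H_inv w) y \<in> carrier (H_group m n)"
      by (intro H_mult_carrier H_inv_carrier y subsetD[OF N(2) w(1)])
    moreover have "0 \<le> \<phi> (H_mult (H_inv w) y)"
      using k neg by (simp add: \<phi>_mult \<phi>_inv w algebra_simps)
    ultimately show "\<exists>w\<in>N. H_mult (H_inv w) y \<in> {x \<in> carrier (H_group m n). 0 \<le> \<phi> x}"
      using w(1) by blast
  qed (use g in \<open>auto simp: \<phi>_mult \<phi>_inv H_mult_carrier\<close>)
  then show ?thesis by (simp add: \<phi>_def)
qed

text \<open>
  The similarity \<open>x \<mapsto> e\<^sup>a x + b\<close> of \<open>\<real>\<^sup>n\<close> descends along the linear form \<open>\<nu>\<close> to this affine map of the line.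
\<close>

definition line_act :: "nat \<Rightarrow> (nat \<Rightarrow> real) \<Rightarrow> H_point \<Rightarrow> real \<Rightarrow> real"
  where "line_act n \<nu> x t = exp (log_scale x) * t + (\<Sum>i<n. \<nu> i * offset x i)"

lemma line_act_mult: "line_act n \<nu> (H_mult x y) t = line_act n \<nu> x (line_act n \<nu> y t)"
  by (cases x; cases y)
     (simp add: line_act_def algebra_simps sum.distrib sum_distrib_left exp_add)

lemma line_act_inv: "line_act n \<nu> (H_inv x) (line_act n \<nu> x t) = t"
  by (subst line_act_mult [symmetric]) (simp add: line_act_def)

lemma line_act_mono: "line_act n \<nu> x s \<le> line_act n \<nu> x t \<longleftrightarrow> s \<le> t"
  by (simp add: line_act_def)

text \<open>
  The half-space consists of the elements that map the ray \<open>[p, \<infinity>)\<close> into itself. An element \<open>x\<close> outside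
  moves \<open>p\<close> to the left, and following it by a strong dilation about \<open>p\<close>, which lies in the half-space, moves
  \<open>p\<close> as far to the left as desired, in particular beyond its image under any given \<open>y\<close>.
\<close>

lemma maximal_half_space_line:
  assumes c: "i0 < n" "\<nu> i0 \<noteq> 0"
  shows "maximal_subsemigroup (H_group m n) (H_topology m n)
    {x \<in> carrier (H_group m n). p \<le> line_act n \<nu> x p}"
proof -
  let ?C = "carrier (H_group m n)" and ?act = "line_act n \<nu>"
  \<comment> \<open>The element that acts on the line as \<open>q \<mapsto> e\<^sup>s q + t\<close>.\<close>
  define e where "e s t = ((\<lambda>i :: nat. 0 :: real), s :: real, (\<lambda>i. if i = i0 then t / \<nu> i0 else 0))" for s t
  have e: "e s t \<in> ?C" "?act (e s t) q = exp s * q + t" for s t q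
    using c by (auto simp: e_def carrier_H_group line_act_def if_distrib cong: if_cong)
  have cont: "continuous_on UNIV (\<lambda>x. ?act x p)"
    unfolding line_act_def by (intro continuous_intros continuous_on_coordinates)
  show ?thesis
  proof (rule maximal_subsemigroupI[where W = "{x. p < ?act x p}" and g = "e 0 1"])
    show "open {x. p < ?act x p}" using cont by (intro open_Collect_less) auto
    show "H_mult x y \<in> {x \<in> ?C. p \<le> ?act x p}"
      if "x \<in> {x \<in> ?C. p \<le> ?act x p}" "y \<in> {x \<in> ?C. p \<le> ?act x p}" for x y
    proof -
      have "p \<le> ?act x p" using that by simp
      also have "\<dots> \<le> ?act x (?act y p)" using that by (simp add: line_act_mono)
      finally show ?thesis using that by (simp add: line_act_mult H_mult_carrier)
    qed
    have "e 0 1 \<in> {x. p < ?act x p} \<inter> ?C" using e[of 0 1] by auto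
    then show "{x. p < ?act x p} \<inter> ?C \<noteq> {}" by blast
    have "e 0 (-1) = H_inv (e 0 1)" by (auto simp: e_def)
    then show "H_inv (e 0 1) \<notin> {x \<in> ?C. p \<le> ?act x p}" using e(2)[of 0 "-1"] by simp
    fix N x y
    assume N: "\<And>x y. x \<in> N \<Longrightarrow> y \<in> N \<Longrightarrow> H_mult x y \<in> N" "N \<subseteq> ?C" "{x \<in> ?C. p \<le> ?act x p} \<subseteq> N"
      and x: "x \<in> N" "x \<notin> {x \<in> ?C. p \<le> ?act x p}"
      and y: "y \<in> ?C"
    define d where "d = p - ?act x p"
    have d: "d > 0" using x N(2) by (auto simp: d_def)
    define s where "s = (p - ?act y p) / d"
    define w where "w = H_mult (e s (p - exp s * p)) x"
    have "e s (p - exp s * p) \<in> N" using N(3) e by auto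
    then have w: "w \<in> N" unfolding w_def using N(1) x(1) by blast
    have "?act w p = p - exp s * d"
      by (simp add: w_def line_act_mult e d_def algebra_simps)
    moreover have "s * d \<le> exp s * d"
      using d exp_ge_add_one_self[of s] by (intro mult_right_mono) linarith+
    ultimately have "?act w p \<le> ?act y p" using d by (simp add: s_def)
    then have "?act (H_inv w) (?act w p) \<le> ?act (H_inv w) (?act y p)" by (simp add: line_act_mono)
    then have "p \<le> ?act (H_mult (H_inv w) y) p" by (simp add: line_act_mult line_act_inv)
    moreover have "H_mult (H_inv w) y \<in> ?C"
      by (intro H_mult_carrier H_inv_carrier y subsetD[OF N(2) w])
    ultimately show "\<exists>w\<in>N. H_mult (H_inv w) y \<in> {x \<in> ?C. p \<le> ?act x p}"
      using w by blast
  qed (use e[of 0 1] in auto)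
qed

section \<open>Contractions, expansions and their powers\<close>

definition fixpt :: "H_point \<Rightarrow> nat \<Rightarrow> real"
  where "fixpt x i = offset x i / (1 - exp (log_scale x))"

lemma offset_fixpt: "log_scale x \<noteq> 0 \<Longrightarrow> offset x i = (1 - exp (log_scale x)) * fixpt x i"
  by (simp add: fixpt_def)

lemma log_scale_mult [simp]: "log_scale (H_mult x y) = log_scale x + log_scale y"
  by (cases x; cases y) simp

lemma offset_mult [simp]: "offset (H_mult x y) i = offset x i + exp (log_scale x) * offset y i"
  by (cases x; cases y) simp

lemma log_scale_inv [simp]: "log_scale (H_inv x) = - log_scale x"
  by (cases x) simp

lemma offset_inv [simp]: "offset (H_inv x) i = - exp (- log_scale x) * offset x i"
  by (cases x) simp

lemma H_inv_inv [simp]: "H_inv (H_inv x) = x"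
  by (cases x) (simp flip: mult.assoc exp_add)

lemma H_inv_H_mult: "H_inv (H_mult x y) = H_mult (H_inv y) (H_inv x)"
  by (cases x; cases y) (simp add: fun_eq_iff exp_minus exp_add exp_diff field_simps)

lemma fixpt_inv: "log_scale x \<noteq> 0 \<Longrightarrow> fixpt (H_inv x) i = fixpt x i"
  by (simp add: fixpt_def exp_minus field_simps)

lemma log_scale_eq_shadow: "log_scale x = shadow m x (m - 1)"
  by (simp add: shadow_def)

primrec H_pow :: "nat \<Rightarrow> H_point \<Rightarrow> H_point" where
  "H_pow 0 x = translation (\<lambda>i. 0)"
| "H_pow (Suc k) x = H_mult (H_pow k x) x"

lemma shadow_pow: "shadow m (H_pow k x) i = real k * shadow m x i"
  by (induction k) (simp_all add: shadow_mult algebra_simps, simp add: shadow_def)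

lemma log_scale_pow [simp]: "log_scale (H_pow k x) = real k * log_scale x"
  by (induction k) (simp_all add: algebra_simps)

lemma offset_pow:
  assumes "log_scale x \<noteq> 0"
  shows "offset (H_pow k x) i = (1 - exp (real k * log_scale x)) * fixpt x i"
  by (induction k) (simp_all add: offset_fixpt[OF assms] algebra_simps exp_add)

lemma offset_pow_neutral: "log_scale x = 0 \<Longrightarrow> offset (H_pow k x) i = real k * offset x i"
  by (induction k) (simp_all add: algebra_simps)

lemma H_pow_closed:
  assumes "translation (\<lambda>i. 0) \<in> M" "\<And>x y. x \<in> M \<Longrightarrow> y \<in> M \<Longrightarrow> H_mult x y \<in> M" "x \<in> M"
  shows "H_pow k x \<in> M"
  using assms by (induction k) auto

text \<open>
  A power of a contraction \<open>u\<close> moves the origin to \<open>(1 - \<lambda>) q\<close> with \<open>0 < \<lambda> \<le> 1\<close>, where \<open>q\<close> is the fixed point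
  of \<open>u\<close>, and it shrinks whatever was there before; so the translation parts stay bounded whatever the
  exponents are.
\<close>

lemma contraction_products_bounded:
  assumes M: "translation (\<lambda>i. 0) \<in> M" "\<And>x y. x \<in> M \<Longrightarrow> y \<in> M \<Longrightarrow> H_mult x y \<in> M"
    and F: "finite F" "F \<subseteq> M" "\<And>u. u \<in> F \<Longrightarrow> log_scale u < 0"
  shows "\<exists>B. \<forall>k :: H_point \<Rightarrow> nat. \<exists>x\<in>M. (\<forall>i. shadow m x i = (\<Sum>u\<in>F. real (k u) * shadow m u i)) \<and>
    (\<forall>i. \<bar>offset x i\<bar> \<le> B i)"
  using F
proof (induction F)
  case empty
  have "shadow m (translation (\<lambda>i. 0)) i = 0" for i by (simp add: shadow_def)
  then show ?case using M(1) by (intro exI[of _ "\<lambda>i. 0"] allI bexI[of _ "translation (\<lambda>i. 0)"]) simp_all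
next
  case (insert u F)
  have F: "F \<subseteq> M" "\<And>u. u \<in> F \<Longrightarrow> log_scale u < 0" using insert.prems by auto
  from insert.IH[OF F] obtain B where B: "\<forall>k :: H_point \<Rightarrow> nat. \<exists>x\<in>M.
    (\<forall>i. shadow m x i = (\<Sum>u\<in>F. real (k u) * shadow m u i)) \<and> (\<forall>i. \<bar>offset x i\<bar> \<le> B i)" ..
  have u: "u \<in> M" "log_scale u < 0" using insert.prems by auto
  show ?case
  proof (rule exI[of _ "\<lambda>i. \<bar>fixpt u i\<bar> + B i"], intro allI)
    fix k :: "H_point \<Rightarrow> nat"
    obtain x where x: "x \<in> M" "\<And>i. shadow m x i = (\<Sum>u\<in>F. real (k u) * shadow m u i)" "\<And>i. \<bar>offset x i\<bar> \<le> B i"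
      using spec[OF B, of k] by blast
    let ?y = "H_mult (H_pow (k u) u) x"
    define e where "e = exp (real (k u) * log_scale u)"
    have e: "0 \<le> e" "e \<le> 1" using u(2) by (auto simp: e_def mult_nonneg_nonpos)
    have 1: "\<bar>offset ?y i\<bar> \<le> \<bar>fixpt u i\<bar> + B i" for i
    proof -
      have "offset ?y i = (1 - e) * fixpt u i + e * offset x i"
        using u(2) by (simp add: offset_pow e_def)
      also have "\<bar>\<dots>\<bar> \<le> \<bar>(1 - e) * fixpt u i\<bar> + \<bar>e * offset x i\<bar>" by (rule abs_triangle_ineq)
      also have "\<dots> \<le> 1 * \<bar>fixpt u i\<bar> + 1 * B i"
        unfolding abs_mult using e x(3)[of i] by (intro add_mono mult_mono) auto
      finally show ?thesis by simp
    qed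
    have 2: "?y \<in> M" by (rule M(2)[OF H_pow_closed[OF M u(1)] x(1)])
    have 3: "shadow m ?y i = (\<Sum>u\<in>insert u F. real (k u) * shadow m u i)" for i
      using insert.hyps x(2) by (simp add: shadow_mult shadow_pow)
    show "\<exists>x\<in>M. (\<forall>i. shadow m x i = (\<Sum>u\<in>insert u F. real (k u) * shadow m u i)) \<and>
        (\<forall>i. \<bar>offset x i\<bar> \<le> \<bar>fixpt u i\<bar> + B i)"
      by (rule bexI[OF _ 2], intro conjI allI, rule 3, rule 1)
  qed
qed

text \<open>
  Applying a high power of \<open>h\<close> last contracts the bounded contribution of all other letters to the fixed
  point of \<open>h\<close>. Stated for any submonoid \<open>M\<close>, so that it also applies to the inverses of elements of a monoid.
\<close>

lemma contraction_limit:
  fixes k :: "nat \<Rightarrow> H_point \<Rightarrow> nat" and N :: "nat \<Rightarrow> nat"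
  assumes M: "translation (\<lambda>i. 0) \<in> M" "\<And>x y. x \<in> M \<Longrightarrow> y \<in> M \<Longrightarrow> H_mult x y \<in> M"
    and F: "finite F" "F \<subseteq> M" "\<And>u. u \<in> F \<Longrightarrow> log_scale u < 0"
    and h: "h \<in> M" "log_scale h < 0"
    and N: "filterlim N at_top sequentially"
  obtains X where "\<And>j. X j \<in> M"
    "\<And>j i. shadow m (X j) i = real (N j) * shadow m h i + (\<Sum>u\<in>F. real (k j u) * shadow m u i)"
    "\<And>i. (\<lambda>j. offset (X j) i) \<longlonglongrightarrow> fixpt h i"
proof -
  let ?prod = "\<lambda>k x. \<forall>i. shadow m x i = (\<Sum>u\<in>F. real (k u) * shadow m u i)"
  obtain B where "\<forall>k. \<exists>x\<in>M. ?prod k x \<and> (\<forall>i. \<bar>offset x i\<bar> \<le> B i)"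
    using contraction_products_bounded[OF M F] by blast
  then have "\<forall>j. \<exists>x. x \<in> M \<and> ?prod (k j) x \<and> (\<forall>i. \<bar>offset x i\<bar> \<le> B i)"
    by blast
  then have "\<exists>Y. \<forall>j. Y j \<in> M \<and> ?prod (k j) (Y j) \<and> (\<forall>i. \<bar>offset (Y j) i\<bar> \<le> B i)"
    by (rule choice)
  then obtain Y where Y: "\<And>j. Y j \<in> M" "\<And>j. ?prod (k j) (Y j)" "\<And>j i. \<bar>offset (Y j) i\<bar> \<le> B i"
    by blast
  define e where "e j = exp (log_scale h * real (N j))" for j
  have "filterlim (\<lambda>j. real (N j)) at_top sequentially"
    by (rule filterlim_compose[OF filterlim_real_sequentially N])
  then have "filterlim (\<lambda>j. log_scale h * real (N j)) at_bot sequentially"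
    by (intro filterlim_tendsto_neg_mult_at_bot[OF tendsto_const h(2)])
  then have e: "e \<longlonglongrightarrow> 0"
    unfolding e_def by (rule filterlim_compose[OF exp_at_bot])
  show thesis
  proof (rule that[of "\<lambda>j. H_mult (H_pow (N j) h) (Y j)"])
    show "H_mult (H_pow (N j) h) (Y j) \<in> M" for j
      by (rule M(2)[OF H_pow_closed[OF M h(1)] Y(1)])
    show "shadow m (H_mult (H_pow (N j) h) (Y j)) i =
        real (N j) * shadow m h i + (\<Sum>u\<in>F. real (k j u) * shadow m u i)" for i j
      by (simp add: shadow_mult shadow_pow Y(2))
    fix i
    have "(\<lambda>j. e j * offset (Y j) i) \<longlonglongrightarrow> 0"
    proof (rule Lim_null_comparison)
      have "norm (e j * offset (Y j) i) \<le> e j * B i" for j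
        using Y(3)[of j i] by (simp add: e_def abs_mult)
      then show "\<forall>\<^sub>F j in sequentially. norm (e j * offset (Y j) i) \<le> e j * B i" by simp
      show "(\<lambda>j. e j * B i) \<longlonglongrightarrow> 0" using tendsto_mult_left_zero[OF e] by simp
    qed
    then have "(\<lambda>j. (1 - e j) * fixpt h i + e j * offset (Y j) i) \<longlonglongrightarrow> (1 - 0) * fixpt h i + 0"
      by (intro tendsto_intros e)
    then show "(\<lambda>j. offset (H_mult (H_pow (N j) h) (Y j)) i) \<longlonglongrightarrow> fixpt h i"
      using h(2) by (simp add: offset_pow e_def mult.commute)
  qed
qed

text \<open>
  The value of \<open>\<nu>\<close> at the fixed point is the fixed point of the map induced on the line: a contraction moves
  points towards it, an expansion away from it.
\<close>

lemma line_act_fixpt: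
  assumes "log_scale x \<noteq> 0"
  shows "line_act n \<nu> x t - t = (1 - exp (log_scale x)) * ((\<Sum>i<n. \<nu> i * fixpt x i) - t)"
proof -
  have "(\<Sum>i<n. \<nu> i * offset x i) = (1 - exp (log_scale x)) * (\<Sum>i<n. \<nu> i * fixpt x i)"
    by (simp add: offset_fixpt[OF assms] sum_distrib_left mult_ac)
  then show ?thesis by (simp add: line_act_def algebra_simps)
qed

section \<open>Recurrence of shadows\<close>

text \<open>
  The last two assumptions are what nonseparatedness of a subset of \<open>T\<close> gives through the two families of
  half-spaces; they stand in for the maximal subsemigroups, which the locale does not mention.
\<close>

locale nonseparated_closed_monoid =
  fixes m n :: nat and T :: "H_point set"
  assumes m: "m \<ge> 1"
    and sub: "T \<subseteq> carrier (H_group m n)"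
    and one: "translation (\<lambda>i. 0) \<in> T"
    and mult: "\<And>x y. x \<in> T \<Longrightarrow> y \<in> T \<Longrightarrow> H_mult x y \<in> T"
    and clo: "closed T"
    and shadow_neg: "\<And>c. \<exists>i<m. c i \<noteq> 0 \<Longrightarrow> \<exists>x\<in>T. (\<Sum>i<m. c i * shadow m x i) < 0"
    and act_neg: "\<And>\<nu> p. \<exists>i<n. \<nu> i \<noteq> 0 \<Longrightarrow> \<exists>x\<in>T. line_act n \<nu> x p < p"
begin

lemma offset_vanishes: "x \<in> T \<Longrightarrow> i \<ge> n \<Longrightarrow> offset x i = 0"
  using sub by (auto simp: carrier_H_group)

lemma limit_mem:
  assumes "\<And>j :: nat. x j \<in> T" "l \<in> carrier (H_group m n)"
    and "\<And>i. (\<lambda>j. shadow m (x j) i) \<longlonglongrightarrow> shadow m l i"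
    and "\<And>i. (\<lambda>j. offset (x j) i) \<longlonglongrightarrow> offset l i"
  shows "l \<in> T"
proof -
  have fst_eq: "fst y i = (if i = m - 1 then 0 else shadow m y i)" if "y \<in> carrier (H_group m n)" for y i
    using that by (auto simp: carrier_H_group shadow_def)
  have fst_x: "fst (x j) i = (if i = m - 1 then 0 else shadow m (x j) i)" for i j
    using assms(1) sub by (intro fst_eq) auto
  have "(fst l, log_scale l, offset l) \<in> T"
  proof (rule closed_H_limit[OF clo assms(1)])
    show "(\<lambda>j. fst (x j) i) \<longlonglongrightarrow> fst l i" for i
      unfolding fst_x fst_eq[OF assms(2)] using assms(3) by simp
    show "(\<lambda>j. log_scale (x j)) \<longlonglongrightarrow> log_scale l"
      unfolding log_scale_eq_shadow[of _ m] by (rule assms(3))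
  qed (rule assms(4))
  then show ?thesis by simp
qed

lemma contraction_exists: "\<exists>h\<in>T. log_scale h < 0"
  and expansion_exists: "\<exists>g\<in>T. log_scale g > 0"
proof -
  have *: "(\<Sum>i<m. (if i = m - 1 then s else 0) * shadow m x i) = s * log_scale x" for s x
    using m by (simp add: log_scale_eq_shadow[of x m] if_distrib[of "\<lambda>c. c * _"] cong: if_cong)
  show "\<exists>h\<in>T. log_scale h < 0"
    using shadow_neg[of "\<lambda>i. if i = m - 1 then 1 else 0"] m unfolding *
    by (auto simp: intro!: exI[of _ "m - 1"])
  show "\<exists>g\<in>T. log_scale g > 0"
    using shadow_neg[of "\<lambda>i. if i = m - 1 then - 1 else 0"] m unfolding *
    by (auto simp: intro!: exI[of _ "m - 1"])
qed

text \<open>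
  Elements with \<open>log_scale u = 0\<close> act as translations of \<open>\<real>\<^sup>n\<close>, and no contraction controls their powers, so
  words should avoid them. They are dispensable: a linear form that is nonnegative on all other shadows is also
  nonnegative at such a \<open>u\<close>, since \<open>u\<^sup>k h\<close> is a contraction for every \<open>k\<close> when \<open>h\<close> is one.
\<close>

lemma shadows_positively_span:
  assumes z: "\<forall>i\<ge>m. z i = 0"
  shows "\<exists>F r. finite F \<and> F \<subseteq> {u \<in> T. log_scale u \<noteq> 0} \<and> (\<forall>u. r u \<ge> 0) \<and>
    (\<forall>i. z i = (\<Sum>u\<in>F. r u * shadow m u i))"
proof -
  \<comment> \<open>Coefficients vanish outside \<open>F\<close>, so that two combinations can be added over the union of their supports.\<close>
  define P where "P F r z \<longleftrightarrow> finite F \<and> F \<subseteq> {u \<in> T. log_scale u \<noteq> 0} \<and> (\<forall>u. r u \<ge> 0) \<and>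
    (\<forall>u. u \<notin> F \<longrightarrow> r u = (0 :: real)) \<and> (\<forall>i. z i = (\<Sum>u\<in>F. r u * shadow m u i))" for F r z
  define K where "K = {z. \<exists>F r. P F r z}"
  have "z \<in> K"
  proof (rule ccontr)
    assume "z \<notin> K"
    have "\<exists>c. (\<exists>i<m. c i \<noteq> 0) \<and> (\<forall>x\<in>K. 0 \<le> (\<Sum>i<m. c i * x i))"
    proof (rule convex_cone_separation[OF _ _ _ _ z \<open>z \<notin> K\<close>])
      show "x i = 0" if x: "x \<in> K" and i: "i \<ge> m" for x i
      proof -
        obtain F r where "P F r x" using x unfolding K_def by blast
        then have F: "F \<subseteq> T" "x i = (\<Sum>u\<in>F. r u * shadow m u i)" by (auto simp: P_def)
        have "shadow m u i = 0" if "u \<in> F" for u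
          using that F(1) sub m i by (intro shadow_vanishes) auto
        then show ?thesis using F(2) by simp
      qed
      show "(\<lambda>i. 0) \<in> K" unfolding K_def by (auto simp: P_def intro!: exI[of _ "{}"] exI[of _ "\<lambda>u. 0"])
      show "(\<lambda>i. s * x i) \<in> K" if x: "x \<in> K" and s: "s > 0" for x s
      proof -
        obtain F r where F: "P F r x" using x unfolding K_def by blast
        then have "P F (\<lambda>u. s * r u) (\<lambda>i. s * x i)"
          using s by (simp add: P_def sum_distrib_left mult.assoc)
        then show ?thesis unfolding K_def by blast
      qed
      show "(\<lambda>i. x i + y i) \<in> K" if x: "x \<in> K" and y: "y \<in> K" for x y
      proof -
        obtain F r where F: "P F r x" using x unfolding K_def by blast
        obtain G s where G: "P G s y" using y unfolding K_def by blast
        have 1: "(\<Sum>u\<in>F. r u * shadow m u i) = (\<Sum>u\<in>F \<union> G. r u * shadow m u i)" for i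
          using F G by (intro sum.mono_neutral_left) (auto simp: P_def)
        have 2: "(\<Sum>u\<in>G. s u * shadow m u i) = (\<Sum>u\<in>F \<union> G. s u * shadow m u i)" for i
          using F G by (intro sum.mono_neutral_left) (auto simp: P_def)
        have "P (F \<union> G) (\<lambda>u. r u + s u) (\<lambda>i. x i + y i)"
          using F G unfolding P_def by (simp add: 1 2 sum.distrib distrib_right)
        then show ?thesis unfolding K_def by blast
      qed
    qed
    then obtain c where c: "\<exists>i<m. c i \<noteq> 0" and cK: "\<And>x. x \<in> K \<Longrightarrow> 0 \<le> (\<Sum>i<m. c i * x i)" by blast
    define \<phi> where "\<phi> x = (\<Sum>i<m. c i * shadow m x i)" for x
    have nonneutral: "\<phi> u \<ge> 0" if "u \<in> T" "log_scale u \<noteq> 0" for u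
    proof -
      have "P {u} (\<lambda>v. if v = u then 1 else 0) (shadow m u)" using that by (auto simp: P_def)
      then have "shadow m u \<in> K" unfolding K_def by blast
      then show ?thesis unfolding \<phi>_def by (rule cK)
    qed
    have "\<phi> u \<ge> 0" if u: "u \<in> T" for u
    proof (cases "log_scale u = 0")
      case True
      obtain h where h: "h \<in> T" "log_scale h < 0" using contraction_exists by blast
      have \<phi>: "0 \<le> real k * \<phi> u + \<phi> h" for k
      proof -
        have "0 \<le> \<phi> (H_mult (H_pow k u) h)"
          using h True by (intro nonneutral mult H_pow_closed[OF one mult u]) auto
        then show ?thesis
          by (simp add: \<phi>_def shadow_mult shadow_pow algebra_simps sum.distrib sum_distrib_left)
      qed
      show ?thesis
      proof (rule ccontr)
        assume "\<not> 0 \<le> \<phi> u"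
        then obtain k :: nat where "\<phi> h < real k * - \<phi> u"
          using reals_Archimedean3[of "- \<phi> u"] by auto
        with \<phi>[of k] show False by simp
      qed
    qed (use nonneutral u in blast)
    with shadow_neg[OF c] show False by (force simp: \<phi>_def)
  qed
  then obtain F r where "P F r z" unfolding K_def by blast
  then show ?thesis unfolding P_def by (intro exI[of _ F] exI[of _ r]) simp
qed

text \<open>
  Write \<open>z\<close> as a nonnegative combination of shadows and approximate the coefficients simultaneously.
  With \<open>z\<close> the negative of a shadow, this yields words whose shadow tends to zero.
\<close>

lemma shadow_recurrence:
  assumes z: "\<forall>i\<ge>m. z i = 0"
  obtains F and N :: "nat \<Rightarrow> nat" and k :: "nat \<Rightarrow> H_point \<Rightarrow> nat"
  where "finite F" "F \<subseteq> {u \<in> T. log_scale u \<noteq> 0}" "\<And>j. N j > 0" "filterlim N at_top sequentially"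
    "\<And>i. (\<lambda>j. real (N j) * z i - (\<Sum>u\<in>F. real (k j u) * shadow m u i)) \<longlonglongrightarrow> 0"
proof -
  obtain F r where F: "finite F" "F \<subseteq> {u \<in> T. log_scale u \<noteq> 0}" and r: "\<And>u. r u \<ge> 0"
    and zr: "\<And>i. z i = (\<Sum>u\<in>F. r u * shadow m u i)"
    using shadows_positively_span[OF z] by blast
  have "\<exists>N k. N > j \<and> (\<forall>u\<in>F. \<bar>real N * r u - real (k u)\<bar> < 1 / real (Suc j))" for j
    by (intro Dirichlet_approx_finite F(1) r) simp
  then obtain N k where N: "\<And>j. N j > j"
    and k: "\<And>j u. u \<in> F \<Longrightarrow> \<bar>real (N j) * r u - real (k j u)\<bar> < 1 / real (Suc j)" by metis
  show thesis
  proof (rule that[OF F])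
    show "N j > 0" for j using N[of j] by simp
    show "filterlim N at_top sequentially"
      using N by (intro filterlim_at_top_mono[OF filterlim_ident]) (auto intro: always_eventually less_imp_le)
    fix i
    have "(\<lambda>j. \<Sum>u\<in>F. (real (N j) * r u - real (k j u)) * shadow m u i) \<longlonglongrightarrow> 0"
    proof (rule tendsto_null_sum)
      fix u assume u: "u \<in> F"
      have "(\<lambda>j. real (N j) * r u - real (k j u)) \<longlonglongrightarrow> 0"
      proof (rule Lim_null_comparison)
        show "\<forall>\<^sub>F j in sequentially. norm (real (N j) * r u - real (k j u)) \<le> 1 / real (Suc j)"
          using k[OF u] by (auto intro!: always_eventually less_imp_le)
        show "(\<lambda>j. 1 / real (Suc j)) \<longlonglongrightarrow> 0" by (rule LIMSEQ_Suc[OF lim_1_over_n])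
      qed
      then show "(\<lambda>j. (real (N j) * r u - real (k j u)) * shadow m u i) \<longlonglongrightarrow> 0"
        by (rule tendsto_mult_left_zero)
    qed
    then show "(\<lambda>j. real (N j) * z i - (\<Sum>u\<in>F. real (k j u) * shadow m u i)) \<longlonglongrightarrow> 0"
      by (simp add: zr algebra_simps sum_distrib_left sum_subtractf)
  qed
qed


section \<open>Translations\<close>

text \<open>
  The relation \<open>N (shadow h + shadow g) + (\<Sum>u\<in>F. k\<^sub>u shadow u) \<approx> 0\<close> is realised by a word \<open>X Y\<^sup>-\<^sup>1\<close>, where \<open>X\<close>
  is \<open>h\<^sup>N\<close> times the contractions and \<open>Y\<close> is the corresponding word in the inverses of the expansions. Both
  \<open>X\<close> and \<open>Y\<close> are products of contractions, so their translation parts tend to the fixed points of \<open>h\<close> and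
  \<open>g\<close>; and as the total dilation factor tends to 1, the translation part of \<open>X Y\<^sup>-\<^sup>1\<close> tends to the difference.
\<close>

lemma translation_between_fixpts:
  assumes h: "h \<in> T" "log_scale h < 0" and g: "g \<in> T" "log_scale g > 0"
  shows "translation (\<lambda>i. fixpt h i - fixpt g i) \<in> T"
proof -
  define z where "z i = - (shadow m h i + shadow m g i)" for i
  have "\<forall>i\<ge>m. z i = 0"
    using shadow_vanishes[OF subsetD[OF sub h(1)] m] shadow_vanishes[OF subsetD[OF sub g(1)] m]
    by (simp add: z_def)
  then obtain F and N :: "nat \<Rightarrow> nat" and k :: "nat \<Rightarrow> H_point \<Rightarrow> nat"
    where F: "finite F" "F \<subseteq> {u \<in> T. log_scale u \<noteq> 0}" and "\<And>j. N j > 0" and N: "filterlim N at_top sequentially"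
      and lim: "\<And>i. (\<lambda>j. real (N j) * z i - (\<Sum>u\<in>F. real (k j u) * shadow m u i)) \<longlonglongrightarrow> 0"
    using shadow_recurrence that by blast
  define Fc where "Fc = {u \<in> F. log_scale u < 0}"
  define Fe where "Fe = {u \<in> F. log_scale u > 0}"
  have split: "(\<Sum>u\<in>F. f u) = (\<Sum>u\<in>Fc. f u) + (\<Sum>u\<in>Fe. f u)" for f :: "H_point \<Rightarrow> real"
  proof -
    have "F = Fc \<union> Fe" using F(2) by (auto simp: Fc_def Fe_def linorder_neq_iff)
    moreover have "(\<Sum>u\<in>Fc \<union> Fe. f u) = (\<Sum>u\<in>Fc. f u) + (\<Sum>u\<in>Fe. f u)"
      using F(1) by (intro sum.union_disjoint) (auto simp: Fc_def Fe_def)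
    ultimately show ?thesis by simp
  qed
  have Fc: "finite Fc" "Fc \<subseteq> T" "\<And>u. u \<in> Fc \<Longrightarrow> log_scale u < 0" using F by (auto simp: Fc_def)
  obtain X where X: "\<And>j. X j \<in> T"
    "\<And>j i. shadow m (X j) i = real (N j) * shadow m h i + (\<Sum>u\<in>Fc. real (k j u) * shadow m u i)"
    "\<And>i. (\<lambda>j. offset (X j) i) \<longlonglongrightarrow> fixpt h i"
    using contraction_limit[OF one mult Fc h N, where m = m and k = k] by blast
  let ?T' = "H_inv ` T" and ?Fe' = "H_inv ` Fe"
  have inj: "inj_on H_inv A" for A by (rule inj_on_inverseI[of _ H_inv]) simp
  have one': "translation (\<lambda>i. 0) \<in> ?T'" using imageI[OF one, of H_inv] by simp
  have mult': "H_mult x y \<in> ?T'" if "x \<in> ?T'" "y \<in> ?T'" for x y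
  proof -
    from that obtain x' y' where "x' \<in> T" "y' \<in> T" "x = H_inv x'" "y = H_inv y'" by blast
    then show ?thesis using imageI[OF mult[of y' x'], of H_inv] by (simp add: H_inv_H_mult)
  qed
  have Fe: "finite ?Fe'" "?Fe' \<subseteq> ?T'" "\<And>u. u \<in> ?Fe' \<Longrightarrow> log_scale u < 0" using F by (auto simp: Fe_def)
  have g': "H_inv g \<in> ?T'" "log_scale (H_inv g) < 0" using g by auto
  obtain Y where Y: "\<And>j. Y j \<in> ?T'"
    "\<And>j i. shadow m (Y j) i = real (N j) * shadow m (H_inv g) i +
      (\<Sum>u\<in>?Fe'. real (k j (H_inv u)) * shadow m u i)"
    "\<And>i. (\<lambda>j. offset (Y j) i) \<longlonglongrightarrow> fixpt (H_inv g) i"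
    using contraction_limit[OF one' mult' Fe g' N, where m = m and k = "\<lambda>j u. k j (H_inv u)"] by blast
  define Z where "Z j = H_mult (X j) (H_inv (Y j))" for j
  have shadow_Z: "shadow m (Z j) i = - (real (N j) * z i - (\<Sum>u\<in>F. real (k j u) * shadow m u i))" for i j
    by (simp add: Z_def shadow_mult shadow_inv X(2) Y(2) split z_def algebra_simps
        sum.reindex[OF inj] sum_negf)
  have shadow_lim: "(\<lambda>j. shadow m (Z j) i) \<longlonglongrightarrow> 0" for i
    unfolding shadow_Z using tendsto_minus[OF lim] by simp
  have offset_Z: "offset (Z j) i = offset (X j) i - exp (log_scale (Z j)) * offset (Y j) i" for i j
    by (simp add: Z_def exp_diff exp_minus field_simps)
  have log_scale_lim: "(\<lambda>j. log_scale (Z j)) \<longlonglongrightarrow> 0"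
    unfolding log_scale_eq_shadow[of _ m] by (rule shadow_lim)
  show ?thesis
  proof (rule limit_mem[of Z])
    show "Z j \<in> T" for j
    proof -
      obtain y where "y \<in> T" "Y j = H_inv y" using Y(1)[of j] by blast
      then show ?thesis using mult[OF X(1)[of j]] by (simp add: Z_def)
    qed
    show "translation (\<lambda>i. fixpt h i - fixpt g i) \<in> carrier (H_group m n)"
      using offset_vanishes[OF h(1)] offset_vanishes[OF g(1)] by (simp add: carrier_H_group fixpt_def)
    show "(\<lambda>j. shadow m (Z j) i) \<longlonglongrightarrow> shadow m (translation (\<lambda>i. fixpt h i - fixpt g i)) i" for i
      using shadow_lim by (simp add: shadow_def)
    have "(\<lambda>j. offset (Z j) i) \<longlonglongrightarrow> fixpt h i - exp 0 * fixpt (H_inv g) i" for i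
      unfolding offset_Z by (intro tendsto_intros X Y log_scale_lim)
    then show "(\<lambda>j. offset (Z j) i) \<longlonglongrightarrow> offset (translation (\<lambda>i. fixpt h i - fixpt g i)) i" for i
      using g(2) by (simp add: fixpt_inv)
  qed
qed

lemma translation_limit:
  assumes "\<And>j :: nat. translation (b j) \<in> T" and "\<And>i. (\<lambda>j. b j i) \<longlonglongrightarrow> l i"
  shows "translation l \<in> T"
  by (rule closed_H_limit[OF clo, where x = "\<lambda>j. translation (b j)"]) (simp_all add: assms)

text \<open>
  Precomposing the power \<open>h\<^sup>j\<close>, of ratio \<open>\<lambda>\<close>, with the translation by \<open>k c\<close> moves its fixed point by
  \<open>k c \<lambda> / (1 - \<lambda>)\<close>. The step \<open>\<delta> = \<lambda> / (1 - \<lambda>)\<close> tends to 0 as \<open>j\<close> grows, so \<open>k \<delta>\<close> can approach any \<open>r \<ge> 0\<close>.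
\<close>

lemma translations_scaled:
  assumes h: "h \<in> T" "log_scale h < 0" and g: "g \<in> T" "log_scale g > 0" and c: "translation c \<in> T" and r: "r \<ge> 0"
  shows "translation (\<lambda>i. fixpt h i - fixpt g i + r * c i) \<in> T"
proof -
  define e where "e j = exp (log_scale h * real (Suc j))" for j
  have "filterlim (\<lambda>j. real (Suc j)) at_top sequentially"
    by (rule filterlim_compose[OF filterlim_real_sequentially filterlim_Suc])
  then have "filterlim (\<lambda>j. log_scale h * real (Suc j)) at_bot sequentially"
    by (intro filterlim_tendsto_neg_mult_at_bot[OF tendsto_const h(2)])
  then have e: "e \<longlonglongrightarrow> 0"
    unfolding e_def by (rule filterlim_compose[OF exp_at_bot])
  have e1: "0 < e j" "e j < 1" for j using h(2) by (auto simp: e_def mult_neg_pos)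
  define \<delta> where "\<delta> j = e j / (1 - e j)" for j
  have \<delta>_pos: "\<delta> j > 0" for j using e1 by (simp add: \<delta>_def)
  have "\<delta> \<longlonglongrightarrow> 0 / (1 - 0)" unfolding \<delta>_def by (intro tendsto_intros e) simp
  then have \<delta>: "\<delta> \<longlonglongrightarrow> 0" by simp
  define k where "k j = nat \<lfloor>r / \<delta> j\<rfloor>" for j
  have k: "\<bar>real (k j) * \<delta> j - r\<bar> \<le> \<delta> j" for j
  proof -
    have k: "real (k j) = of_int \<lfloor>r / \<delta> j\<rfloor>" using r \<delta>_pos[of j] by (simp add: k_def)
    have "of_int \<lfloor>r / \<delta> j\<rfloor> * \<delta> j \<le> r / \<delta> j * \<delta> j" "r / \<delta> j * \<delta> j \<le> (of_int \<lfloor>r / \<delta> j\<rfloor> + 1) * \<delta> j"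
      using \<delta>_pos[of j] by (intro mult_right_mono; linarith)+
    moreover have "r / \<delta> j * \<delta> j = r" using \<delta>_pos[of j] by simp
    ultimately show ?thesis unfolding k by (simp add: algebra_simps abs_le_iff)
  qed
  have k_lim: "(\<lambda>j. real (k j) * \<delta> j) \<longlonglongrightarrow> r"
  proof (rule LIM_zero_cancel, rule Lim_null_comparison[OF _ \<delta>])
    show "\<forall>\<^sub>F j in sequentially. norm (real (k j) * \<delta> j - r) \<le> \<delta> j" using k by simp
  qed
  define x where "x j = H_mult (H_pow (Suc j) h) (H_pow (k j) (translation c))" for j
  have x: "x j \<in> T" for j unfolding x_def by (intro mult H_pow_closed[OF one mult] h c)
  have log_scale_x: "log_scale (x j) = log_scale h * real (Suc j)" for j
    by (simp add: x_def algebra_simps)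
  have "fixpt (x j) i = fixpt h i + real (k j) * \<delta> j * c i" for i j
  proof -
    have "offset (x j) i = (1 - e j) * fixpt h i + e j * (real (k j) * c i)"
      unfolding x_def offset_mult
      using h(2) by (subst offset_pow) (simp_all add: offset_pow_neutral e_def mult.commute del: H_pow.simps)
    moreover have "exp (log_scale (x j)) = e j" by (simp only: log_scale_x e_def)
    ultimately show ?thesis
      using e1(2)[of j] by (simp only: fixpt_def[of "x j"]) (simp add: \<delta>_def field_simps)
  qed
  moreover have "log_scale (x j) < 0" for j using h(2) unfolding log_scale_x by (simp add: mult_neg_pos del: of_nat_Suc)
  ultimately have mem: "translation (\<lambda>i. fixpt h i + real (k j) * \<delta> j * c i - fixpt g i) \<in> T" for j
    using translation_between_fixpts[OF x[of j] _ g] by simp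
  have "(\<lambda>j. fixpt h i + real (k j) * \<delta> j * c i - fixpt g i) \<longlonglongrightarrow> fixpt h i + r * c i - fixpt g i" for i
    by (intro tendsto_intros k_lim)
  then show ?thesis
    using translation_limit[of "\<lambda>j i. fixpt h i + real (k j) * \<delta> j * c i - fixpt g i", OF mem]
    by (simp add: algebra_simps)
qed


text \<open>
  If \<open>\<nu>\<close> put all fixed points of expansions to the left of all fixed points of contractions, no
  contraction and no expansion would move the supremum \<open>p\<close> of the former to the left. Neither would a \<open>u\<close>
  that acts as a translation: otherwise the expansions \<open>u\<^sup>k g\<close> would have fixed points arbitrarily
  far to the right.
\<close>

lemma fixpts_not_separated:
  assumes \<nu>: "\<exists>i<n. \<nu> i \<noteq> 0"
  shows "\<exists>h\<in>T. \<exists>g\<in>T. log_scale h < 0 \<and> log_scale g > 0 \<and>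
    (\<Sum>i<n. \<nu> i * fixpt h i) < (\<Sum>i<n. \<nu> i * fixpt g i)"
proof (rule ccontr)
  assume not: "\<not> ?thesis"
  define val where "val x = (\<Sum>i<n. \<nu> i * fixpt x i)" for x
  define P where "P = {g \<in> T. log_scale g > 0}"
  have le: "val g \<le> val h" if "g \<in> P" "h \<in> T" "log_scale h < 0" for g h
    using not that by (fastforce simp: val_def P_def not_less)
  obtain h where h: "h \<in> T" "log_scale h < 0" using contraction_exists by blast
  obtain g where g: "g \<in> P" using expansion_exists by (auto simp: P_def)
  define p where "p = (SUP g\<in>P. val g)"
  have bdd: "bdd_above (val ` P)" using le[OF _ h] by (intro bdd_aboveI2)
  have p_ge: "val g' \<le> p" if "g' \<in> P" for g'
    unfolding p_def using that bdd by (rule cSUP_upper)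
  have p_le: "p \<le> val h'" if "h' \<in> T" "log_scale h' < 0" for h'
    unfolding p_def using g le[OF _ that] by (intro cSUP_least) auto
  obtain x where x: "x \<in> T" "line_act n \<nu> x p < p" using act_neg[OF \<nu>] by blast
  have lt: "(1 - exp (log_scale x)) * (val x - p) < 0" if "log_scale x \<noteq> 0"
    using line_act_fixpt[OF that, of n \<nu> p] x(2) by (simp add: val_def)
  consider "log_scale x > 0" | "log_scale x < 0" | "log_scale x = 0" by linarith
  then show False
  proof cases
    case 1
    then have "(1 - exp (log_scale x)) * (val x - p) \<ge> 0"
      using x(1) p_ge[of x] by (intro mult_nonpos_nonpos) (auto simp: P_def)
    with lt 1 show False by simp
  next
    case 2
    then have "(1 - exp (log_scale x)) * (val x - p) \<ge> 0"
      using x(1) p_le[of x] by (intro mult_nonneg_nonneg) auto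
    with lt 2 show False by simp
  next
    case 3
    define s where "s = - (\<Sum>i<n. \<nu> i * offset x i)"
    have s: "s > 0" using x(2) 3 by (simp add: line_act_def s_def)
    define d where "d = exp (log_scale g) - 1"
    have d: "d > 0" using g by (simp add: d_def P_def)
    have "val g + real k * s / d \<le> p" for k
    proof -
      let ?y = "H_mult (H_pow k x) g"
      have "fixpt ?y i = fixpt g i - real k * offset x i / d" for i
      proof -
        have "fixpt ?y i = - (real k * offset x i + offset g i) / d"
          using d 3 by (simp add: fixpt_def offset_pow_neutral d_def divide_simps) (simp add: algebra_simps)
        moreover have "fixpt g i = - offset g i / d"
          using d by (simp add: fixpt_def d_def divide_simps) (simp add: algebra_simps)
        ultimately show ?thesis by (simp add: diff_divide_distrib)
      qed
      then have "val ?y = val g + real k * s / d"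
        by (simp add: val_def s_def sum_subtractf right_diff_distrib sum_distrib_left sum_divide_distrib mult_ac
            flip: sum_negf)
      moreover have "?y \<in> P"
        using g 3 mult[OF H_pow_closed[OF one mult x(1)]] by (simp add: P_def)
      ultimately show ?thesis using p_ge[of ?y] by simp
    qed
    moreover obtain k :: nat where "p - val g < real k * (s / d)"
      using reals_Archimedean3[of "s / d"] s d by auto
    ultimately show False by (simp add: algebra_simps not_le[symmetric])
  qed
qed

text \<open>
  The set \<open>E\<close> of recession directions is a convex cone. It is closed under addition because
  \<open>(d + N x) + (d + N y)\<close> is a translation in \<open>T\<close>, and scaling it by \<open>r / N\<close> as in \<open>translations_scaled\<close>
  gives \<open>r (x + y)\<close> up to the error \<open>2 r d / N\<close>.
\<close>

lemma all_translations:
  assumes b: "\<forall>i\<ge>n. b i = 0"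
  shows "translation b \<in> T"
proof -
  obtain h where h: "h \<in> T" "log_scale h < 0" using contraction_exists by blast
  obtain g where g: "g \<in> T" "log_scale g > 0" using expansion_exists by blast
  define d where "d i = fixpt h i - fixpt g i" for i
  have d_vanishes: "d i = 0" if "i \<ge> n" for i
    using that offset_vanishes[OF h(1)] offset_vanishes[OF g(1)] by (simp add: d_def fixpt_def)
  have scaled: "translation (\<lambda>i. d i + r * c i) \<in> T" if "translation c \<in> T" "r \<ge> 0" for c r
    using translations_scaled[OF h g that] by (simp add: d_def)
  have d_mem: "translation d \<in> T" using scaled[OF one, of 0] by simp
  define E where "E = {x. (\<forall>i\<ge>n. x i = 0) \<and> (\<forall>r\<ge>0. translation (\<lambda>i. d i + r * x i) \<in> T)}"
  have C_E: "c \<in> E" if "translation c \<in> T" for c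
    using that scaled offset_vanishes[OF that] by (simp add: E_def)
  have "(\<lambda>i. b i - d i) \<in> E"
  proof (rule ccontr)
    assume notin: "(\<lambda>i. b i - d i) \<notin> E"
    have "\<exists>c. (\<exists>i<n. c i \<noteq> 0) \<and> (\<forall>x\<in>E. 0 \<le> (\<Sum>i<n. c i * x i))"
    proof (rule convex_cone_separation[OF _ _ _ _ _ notin])
      show "x i = 0" if "x \<in> E" "i \<ge> n" for x i using that by (simp add: E_def)
      show "(\<lambda>i. 0) \<in> E" using C_E one by simp
      show "\<forall>i\<ge>n. b i - d i = 0" using b d_vanishes by simp
      show "(\<lambda>i. s * x i) \<in> E" if x: "x \<in> E" and s: "s > 0" for x s
      proof -
        have "translation (\<lambda>i. d i + (r * s) * x i) \<in> T" if "r \<ge> 0" for r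
          using x s that by (simp add: E_def)
        then show ?thesis using x by (simp add: E_def mult.assoc)
      qed
      show "(\<lambda>i. x i + y i) \<in> E" if x: "x \<in> E" and y: "y \<in> E" for x y
      proof -
        have "translation (\<lambda>i. d i + r * (x i + y i)) \<in> T" if r: "r \<ge> 0" for r
        proof -
          let ?c = "\<lambda>j i. (d i + real (Suc j) * x i) + (d i + real (Suc j) * y i)"
          have "translation (?c j) \<in> T" for j
          proof -
            have "translation (\<lambda>i. d i + real (Suc j) * x i) \<in> T" "translation (\<lambda>i. d i + real (Suc j) * y i) \<in> T"
              using x y unfolding E_def by (auto simp del: of_nat_Suc)
            from mult[OF this] show ?thesis by simp
          qed
          then have mem: "translation (\<lambda>i. d i + r / real (Suc j) * ?c j i) \<in> T" for j
            using r by (intro scaled) auto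
          have eq: "d i + r / real (Suc j) * ?c j i = d i + (2 * r * d i) * (1 / real (Suc j)) + r * (x i + y i)" for i j
            by (simp add: field_simps del: of_nat_Suc)
          have "(\<lambda>j. d i + r / real (Suc j) * ?c j i) \<longlonglongrightarrow> d i + (2 * r * d i) * 0 + r * (x i + y i)" for i
            unfolding eq by (intro tendsto_intros LIMSEQ_Suc[OF lim_1_over_n])
          from translation_limit[of "\<lambda>j i. d i + r / real (Suc j) * ?c j i", OF mem this] show ?thesis by simp
        qed
        then show ?thesis using x y by (simp add: E_def)
      qed
    qed
    then obtain \<nu> where \<nu>: "\<exists>i<n. \<nu> i \<noteq> 0" and pos: "\<And>x. x \<in> E \<Longrightarrow> 0 \<le> (\<Sum>i<n. \<nu> i * x i)" by blast
    obtain h' g' where "h' \<in> T" "log_scale h' < 0" "g' \<in> T" "log_scale g' > 0"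
      and less: "(\<Sum>i<n. \<nu> i * fixpt h' i) < (\<Sum>i<n. \<nu> i * fixpt g' i)"
      using fixpts_not_separated[OF \<nu>] by blast
    then have "(\<lambda>i. fixpt h' i - fixpt g' i) \<in> E"
      by (intro C_E translation_between_fixpts)
    from pos[OF this] less show False by (simp add: right_diff_distrib sum_subtractf)
  qed
  then have "\<forall>r\<ge>0. translation (\<lambda>i. d i + r * (b i - d i)) \<in> T" unfolding E_def by blast
  from spec[OF this, of 1] show ?thesis by simp
qed

section \<open>Inverses\<close>

lemma shadow_products:
  assumes "finite F" "F \<subseteq> T"
  shows "\<exists>x\<in>T. \<forall>i. shadow m x i = (\<Sum>u\<in>F. real (k u) * shadow m u i)"
  using assms
proof (induction F)
  case empty
  show ?case by (rule bexI[OF _ one]) (simp add: shadow_def)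
next
  case (insert u F)
  then obtain x where x: "x \<in> T" "\<And>i. shadow m x i = (\<Sum>u\<in>F. real (k u) * shadow m u i)" by auto
  have "u \<in> T" using insert.prems by simp
  show ?case
  proof (rule bexI[of _ "H_mult (H_pow (k u) u) x"])
    show "H_mult (H_pow (k u) u) x \<in> T" by (rule mult[OF H_pow_closed[OF one mult \<open>u \<in> T\<close>] x(1)])
    show "\<forall>i. shadow m (H_mult (H_pow (k u) u) x) i = (\<Sum>u\<in>insert u F. real (k u) * shadow m u i)"
      using insert.hyps by (simp add: shadow_mult shadow_pow x(2))
  qed
qed

text \<open>
  One copy of \<open>x\<close> is removed from words \<open>x\<^sup>N \<dots>\<close> of shadow tending to 0; what remains has shadow tending to that
  of \<open>x\<^sup>-\<^sup>1\<close>, and composing with a translation makes the remaining component equal to that of \<open>x\<^sup>-\<^sup>1\<close>.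
\<close>

lemma inverse_mem:
  assumes x: "x \<in> T"
  shows "H_inv x \<in> T"
proof -
  define z where "z i = - shadow m x i" for i
  have "\<forall>i\<ge>m. z i = 0" using shadow_vanishes[OF subsetD[OF sub x] m] by (simp add: z_def)
  then obtain F and N :: "nat \<Rightarrow> nat" and k :: "nat \<Rightarrow> H_point \<Rightarrow> nat"
    where F: "finite F" "F \<subseteq> {u \<in> T. log_scale u \<noteq> 0}" and N: "\<And>j. N j > 0" and "filterlim N at_top sequentially"
      and lim: "\<And>i. (\<lambda>j. real (N j) * z i - (\<Sum>u\<in>F. real (k j u) * shadow m u i)) \<longlonglongrightarrow> 0"
    using shadow_recurrence that by blast
  have "\<forall>j. \<exists>y. y \<in> T \<and> (\<forall>i. shadow m y i = (\<Sum>u\<in>F. real (k j u) * shadow m u i))"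
    using shadow_products[OF F(1)] F(2) by blast
  then have "\<exists>Y. \<forall>j. Y j \<in> T \<and> (\<forall>i. shadow m (Y j) i = (\<Sum>u\<in>F. real (k j u) * shadow m u i))"
    by (rule choice)
  then obtain Y where Y: "\<And>j. Y j \<in> T" "\<And>j i. shadow m (Y j) i = (\<Sum>u\<in>F. real (k j u) * shadow m u i)"
    by blast
  define W where "W j = H_mult (H_pow (N j - 1) x) (Y j)" for j
  have W: "W j \<in> T" for j unfolding W_def by (rule mult[OF H_pow_closed[OF one mult x] Y(1)])
  have shadow_W: "shadow m (W j) i = z i - (real (N j) * z i - (\<Sum>u\<in>F. real (k j u) * shadow m u i))" for i j
    using N[of j] by (simp add: W_def shadow_mult shadow_pow Y(2) z_def of_nat_diff algebra_simps)
  define c where "c j i = exp (- log_scale (W j)) * (offset (H_inv x) i - offset (W j) i)" for i j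
  have c: "translation (c j) \<in> T" for j
    using offset_vanishes[OF W[of j]] offset_vanishes[OF x] by (intro all_translations) (simp add: c_def)
  have inv_carrier: "H_inv x \<in> carrier (H_group m n)" using H_inv_carrier sub x by blast
  show ?thesis
  proof (rule limit_mem[of "\<lambda>j. H_mult (W j) (translation (c j))", OF _ inv_carrier])
    show "H_mult (W j) (translation (c j)) \<in> T" for j by (rule mult[OF W c])
    have "(\<lambda>j. shadow m (W j) i) \<longlonglongrightarrow> z i - 0" for i
      unfolding shadow_W by (intro tendsto_intros lim)
    moreover have "shadow m (translation (c j)) i = 0" for i j by (simp add: shadow_def)
    ultimately show "(\<lambda>j. shadow m (H_mult (W j) (translation (c j))) i) \<longlonglongrightarrow> shadow m (H_inv x) i" for i
      by (simp add: shadow_mult shadow_inv z_def)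
    have "offset (H_mult (W j) (translation (c j))) i = offset (H_inv x) i" for i j
      by (simp add: c_def del: offset_inv flip: mult.assoc exp_add)
    then show "(\<lambda>j. offset (H_mult (W j) (translation (c j))) i) \<longlonglongrightarrow> offset (H_inv x) i" for i
      by (simp only: tendsto_const)
  qed
qed

end

section \<open>Closures of nonseparated subsemigroups\<close>

lemma generated_subsemigroup_H_group:
  assumes "S \<subseteq> carrier (H_group m n)"
  shows "subsemigroup (H_group m n) (generated_subsemigroup (H_group m n) S)"
    and "S \<subseteq> generated_subsemigroup (H_group m n) S"
proof -
  have "subsemigroup (H_group m n) (carrier (H_group m n))"
    by (simp add: subsemigroup_def H_mult_carrier)
  with assms have "generated_subsemigroup (H_group m n) S \<subseteq> carrier (H_group m n)"
    unfolding generated_subsemigroup_def by (intro hull_minimal)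
  then show "subsemigroup (H_group m n) (generated_subsemigroup (H_group m n) S)"
    unfolding subsemigroup_def generated_subsemigroup_def hull_def by auto
  show "S \<subseteq> generated_subsemigroup (H_group m n) S"
    unfolding generated_subsemigroup_def by (rule hull_subset)
qed

theorem theorem2p10:
  fixes m n :: nat and S U :: "H_point set"
  assumes "m \<ge> 1" and "n \<ge> 1"
    and "S \<subseteq> carrier (H_group m n)"
    and "nonseparated (H_group m n) (H_topology m n) S"
    and "U = generated_subsemigroup (H_group m n) S"
  shows "subgroup (H_topology m n closure_of U) (H_group m n)"
proof -
  let ?C = "carrier (H_group m n)" and ?one = "translation (\<lambda>i. 0)"
  define T where "T = closure U"
  have SU: "S \<subseteq> U" and UC: "U \<subseteq> ?C" and mult_U: "\<And>x y. x \<in> U \<Longrightarrow> y \<in> U \<Longrightarrow> H_mult x y \<in> U"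
    using generated_subsemigroup_H_group[OF assms(3)] assms(5) by (auto simp: subsemigroup_def)
  have ST: "S \<subseteq> T" using SU closure_subset[of U] by (auto simp: T_def)
  have TC: "T \<subseteq> ?C"
    using UC closed_carrier_H_group by (simp add: T_def closure_minimal)
  have mult_T: "H_mult x y \<in> T" if "x \<in> T" "y \<in> T" for x y
    using closure_subsemigroup[OF mult_U] that by (simp add: T_def)
  have not_sub: "\<not> S \<subseteq> M" if "maximal_subsemigroup (H_group m n) (H_topology m n) M" for M
    using assms(4) that by (auto simp: nonseparated_def)
  have 1: "\<exists>x\<in>S. (\<Sum>i<m. c i * shadow m x i) < 0" if c: "\<exists>i<m. c i \<noteq> 0" for c
  proof -
    obtain i where "i < m" "c i \<noteq> 0" using c by blast
    then show ?thesis
      using not_sub[OF maximal_half_space_shadow[OF assms(1)]] assms(3) by fastforce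
  qed
  have 2: "\<exists>x\<in>S. line_act n \<nu> x p < p" if \<nu>: "\<exists>i<n. \<nu> i \<noteq> 0" for \<nu> p
  proof -
    obtain i where "i < n" "\<nu> i \<noteq> 0" using \<nu> by blast
    then show ?thesis
      using not_sub[OF maximal_half_space_line[of i n \<nu> m p]] assms(3) by fastforce
  qed
  \<comment> \<open>The identity is adjoined for now; it turns out to be \<open>h h\<^sup>-\<^sup>1\<close> for a contraction \<open>h\<close>, and so to lie in \<open>T\<close>.\<close>
  interpret nonseparated_closed_monoid m n "insert ?one T"
  proof
    show "m \<ge> 1" by (rule assms(1))
    show "insert ?one T \<subseteq> ?C" using TC by (simp add: carrier_H_group)
    show "?one \<in> insert ?one T" by simp
    show "H_mult x y \<in> insert ?one T" if "x \<in> insert ?one T" "y \<in> insert ?one T" for x y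
      using that mult_T[of x y] by auto
    show "closed (insert ?one T)" by (simp add: T_def)
    show "\<exists>x\<in>insert ?one T. (\<Sum>i<m. c i * shadow m x i) < 0" if "\<exists>i<m. c i \<noteq> 0" for c
      using 1[OF that] ST by blast
    show "\<exists>x\<in>insert ?one T. line_act n \<nu> x p < p" if "\<exists>i<n. \<nu> i \<noteq> 0" for \<nu> p
      using 2[OF that] ST by blast
  qed
  obtain h where h: "h \<in> insert ?one T" "log_scale h < 0" using contraction_exists by blast
  then have "h \<in> T" by auto
  have "H_inv h \<noteq> ?one"
  proof
    assume "H_inv h = ?one"
    then have "log_scale (H_inv h) = 0" by simp
    with h(2) show False by simp
  qed
  then have "H_inv h \<in> T" using inverse_mem[OF h(1)] by simp
  from mult_T[OF \<open>h \<in> T\<close> this] have one_T: "?one \<in> T" by simp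
  have "H_topology m n closure_of U = T"
    using UC TC by (simp add: H_topology_eq closure_of_subtopology T_def Int_absorb1 Int_absorb2)
  moreover have "subgroup T (H_group m n)"
  proof (rule group.subgroupI[OF group_H_group TC])
    show "T \<noteq> {}" using one_T by blast
    show "inv\<^bsub>H_group m n\<^esub> x \<in> T" if x: "x \<in> T" for x
    proof -
      have inv_T: "H_inv x \<in> T" using inverse_mem[of x] x one_T by (simp add: insert_absorb)
      have "inv\<^bsub>H_group m n\<^esub> x = H_inv x"
        by (rule group.inv_equality[OF group_H_group]) (use x inv_T TC in auto)
      with inv_T show ?thesis by simp
    qed
    show "x \<otimes>\<^bsub>H_group m n\<^esub> y \<in> T" if "x \<in> T" "y \<in> T" for x y
      using mult_T[OF that] by simp
  qed
  ultimately show ?thesis by simp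
qed

end
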